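(* Let $L=L(t,x,v)\in C^1([a,b]\times\mathbb{R}^n\times\mathbb{R}^n;\mathbb{R})$ and let $J[x(\cdot)]=\int_a^b L(t,x(t),\dot x(t))\,\mathrm{d}t$. Suppose that $J$ is quasi-invariant (in the sense defined in the context) under the one-parameter group of time-space transformations $$(t,x)\longrightarrow \bigl(T(t,x,\dot x,s),\,X(t,x,\dot x,s)\bigr),\qquad |s|<\varepsilon,$$ up to the gauge-term $\Phi(t,x,\dot x)$. Then the quantity $$\Bigl[L(t,x(t),\dot x(t))-\frac{\partial L}{\partial v}(t,x(t),\dot x(t))\cdot\dot x(t)\Bigr]\,\frac{\partial}{\partial s}T(t,x(t),\dot x(t),s)\Big|_{s=0}+\frac{\partial L}{\partial v}(t,x(t),\dot x(t))\cdot\frac{\partial}{\partial s}X(t,x(t),\dot x(t),s)\Big|_{s=0}-\Phi(t,x(t),\dot x(t))$$ is constant in $t\in[a,b]$ along any $x(\cdot)\in Lip([a,b];\mathbb{R}^n)$ satisfying both the Euler-Lagrange equation $$\frac{\mathrm{d}}{\mathrm{d}t}\frac{\partial L}{\partial v}(t,x(t),\dot x(t))=\frac{\partial L}{\partial x}(t,x(t),\dot x(t))$$ and the DuBois-Reymond condition $$\frac{\partial L}{\partial t}(t,x(t),\dot x(t))=\frac{\mathrm{d}}{\mathrm{d}t}\Bigl\{L(t,x(t),\dot x(t))-\frac{\partial L}{\partial v}(t,x(t),\dot x(t))\cdot\dot x(t)\Bigr\}.$$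
   Context: $Lip([a,b];\mathbb{R}^n)$ denotes the class of Lipschitz functions $x:[a,b]\to\mathbb{R}^n$; such a function has an essentially bounded derivative $\dot x$ defined almost everywhere. Definition (quasi-invariance up to a gauge-term). The integral functional $J$ is quasi-invariant under a one-parameter group of $C^1$-transformations $(t,x)\longrightarrow (T(t,x,\dot x,s),X(t,x,\dot x,s))$, $|s|<\varepsilon$, up to the gauge-term $\Phi(t,x,\dot x)$ (with $T$ and $\Phi$ real-valued and $X$ taking values in $\mathbb{R}^n$) if and only if $$\frac{\mathrm{d}}{\mathrm{d}t}\Phi(t,x(t),\dot x(t))=\frac{\mathrm{d}}{\mathrm{d}s}\left\{L\left(T(t,x(t),\dot x(t),s),\,X(t,x(t),\dot x(t),s),\,\frac{\frac{\mathrm{d}X(t,x(t),\dot x(t),s)}{\mathrm{d}t}}{\frac{\mathrm{d}T(t,x(t),\dot x(t),s)}{\mathrm{d}t}}\right)\frac{\mathrm{d}T(t,x(t),\dot x(t),s)}{\mathrm{d}t}\right\}\Bigg|_{s=0}$$ for all $x(\cdot)\in Lip([a,b];\mathbb{R}^n)$. The transformations are assumed to reduce to the identity for $s=0$: $T(t,x,v,0)=t$ and $X(t,x,v,0)=x$ for any choice of $t$, $x$, $v$. Convention. Since $\dot x$ is defined only almost everywhere, all equations along Lipschitz functions $x(\cdot)$ are interpreted in the almost everywhere sense in $t$. A function of $t$ appearing under $\mathrm{d}/\mathrm{d}t$ is understood to coincide almost everywhere with an absolutely continuous function, whose derivative is meant (so, for instance, the Euler-Lagrange equation with zero right-hand side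 means that $\frac{\partial L}{\partial v}(t,x(t),\dot x(t))$ equals a constant for a.e. $t$). "Constant in $t\in[a,b]$" means equal to one constant for almost every $t\in[a,b]$.
   Formalization: "C^1-transformations" also requires ∂T/∂s and ∂X/∂s to have a continuous derivative in (t,x,v); with T, X only jointly C^1 the claim fails (L=1, Φ=0, X=x, T the flow of 1 + the Cantor function). *)

theory Defs
  imports "HOL-Analysis.Analysis"
begin

definition C1_on :: "('a::real_normed_vector \<Rightarrow> 'b::real_normed_vector) \<Rightarrow> 'a set \<Rightarrow> bool" where
  "C1_on f S \<longleftrightarrow> (\<exists>f'. (\<forall>z\<in>S. (f has_derivative blinfun_apply (f' z)) (at z within S))
                     \<and> continuous_on S f')"

definition Lip :: "real \<Rightarrow> real \<Rightarrow> (real \<Rightarrow> real ^ 'n) set" where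
  "Lip a b = {x. \<exists>C. C-lipschitz_on {a..b} x}"

definition abs_cont :: "real \<Rightarrow> real \<Rightarrow> (real \<Rightarrow> 'a::real_normed_vector) \<Rightarrow> bool" where
  "abs_cont a b F \<longleftrightarrow>
     (\<forall>e>0. \<exists>d>0. \<forall>D. finite D
        \<and> (\<forall>(u, v)\<in>D. a \<le> u \<and> u \<le> v \<and> v \<le> b)
        \<and> pairwise (\<lambda>(u, v) (u', v'). {u<..<v} \<inter> {u'<..<v'} = {}) D
        \<and> (\<Sum>(u, v)\<in>D. v - u) < d
        \<longrightarrow> (\<Sum>(u, v)\<in>D. norm (F v - F u)) < e)"

definition ac_rep :: "real \<Rightarrow> real \<Rightarrow> (real \<Rightarrow> 'a::real_normed_vector) \<Rightarrow> (real \<Rightarrow> 'a) \<Rightarrow> bool" where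
  "ac_rep a b f F \<longleftrightarrow> abs_cont a b F \<and> (AE t in lebesgue_on {a..b}. f t = F t)"

text \<open>
  A function under \<open>d/dt\<close> has to agree almost everywhere with an absolutely continuous function,
  and the derivative of that function is meant. For \<open>a < b\<close> all representatives coincide on
  \<open>[a,b]\<close>, so \<open>ddt a b f t\<close> does not depend on the choice for any \<open>t \<in> [a,b]\<close>. For values in
  a Euclidean space, the last condition in \<open>ddt_exists\<close> follows from the first one by Lebesgue's
  theorem on the differentiation of absolutely continuous functions.
\<close>

definition ddt_exists :: "real \<Rightarrow> real \<Rightarrow> (real \<Rightarrow> 'a::real_normed_vector) \<Rightarrow> bool" where
  "ddt_exists a b f \<longleftrightarrow>
     (\<exists>F. ac_rep a b f F \<and> (AE t in lebesgue_on {a..b}. F differentiable (at t within {a..b})))"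

definition ddt :: "real \<Rightarrow> real \<Rightarrow> (real \<Rightarrow> 'a::real_normed_vector) \<Rightarrow> real \<Rightarrow> 'a" where
  "ddt a b f t = vector_derivative (SOME F. ac_rep a b f F) (at t within {a..b})"

definition velocity :: "real \<Rightarrow> real \<Rightarrow> (real \<Rightarrow> real ^ 'n) \<Rightarrow> real \<Rightarrow> real ^ 'n" where
  "velocity a b x t = vector_derivative x (at t within {a..b})"

text \<open>Evaluation of a function of \<open>(t,x,v)\<close> along a trajectory.\<close>

definition along ::
    "real \<Rightarrow> real \<Rightarrow> (real \<Rightarrow> real ^ 'n) \<Rightarrow> (real \<Rightarrow> real ^ 'n \<Rightarrow> real ^ 'n \<Rightarrow> 'b) \<Rightarrow> real \<Rightarrow> 'b" where
  "along a b x f t = f t (x t) (velocity a b x t)"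

definition grad :: "('a::real_inner \<Rightarrow> real) \<Rightarrow> 'a \<Rightarrow> 'a" where
  "grad f x = (THE D. GDERIV f x :> D)"

definition L_t ::
    "real \<Rightarrow> real \<Rightarrow> (real \<Rightarrow> real ^ 'n \<Rightarrow> real ^ 'n \<Rightarrow> real) \<Rightarrow> real \<Rightarrow> real ^ 'n \<Rightarrow> real ^ 'n \<Rightarrow> real" where
  "L_t a b L t x v = vector_derivative (\<lambda>\<tau>. L \<tau> x v) (at t within {a..b})"

definition L_x ::
    "(real \<Rightarrow> real ^ 'n \<Rightarrow> real ^ 'n \<Rightarrow> real) \<Rightarrow> real \<Rightarrow> real ^ 'n \<Rightarrow> real ^ 'n \<Rightarrow> real ^ 'n" where
  "L_x L t x v = grad (\<lambda>y. L t y v) x"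

definition L_v ::
    "(real \<Rightarrow> real ^ 'n \<Rightarrow> real ^ 'n \<Rightarrow> real) \<Rightarrow> real \<Rightarrow> real ^ 'n \<Rightarrow> real ^ 'n \<Rightarrow> real ^ 'n" where
  "L_v L t x v = grad (L t x) v"

definition d_s ::
    "(real \<Rightarrow> real ^ 'n \<Rightarrow> real ^ 'n \<Rightarrow> real \<Rightarrow> 'b::real_normed_vector)
      \<Rightarrow> real \<Rightarrow> real ^ 'n \<Rightarrow> real ^ 'n \<Rightarrow> real \<Rightarrow> 'b" where
  "d_s Y t x v s = vector_derivative (Y t x v) (at s)"

text \<open>
  The second clause of \<open>C1_family\<close> makes \<open>s \<mapsto> Y(\<cdot>,s)\<close> continuously differentiable as a curve of
  \<open>C\<^sup>1\<close> functions of \<open>(t,x,v)\<close>: the \<open>(t,x,v)\<close>-derivative of \<open>\<partial>Y/\<partial>s\<close> exists and is continuous.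
  Joint \<open>C\<^sup>1\<close> smoothness alone does not allow one to interchange \<open>d/ds\<close> and \<open>d/dt\<close>, and Noether's
  theorem then fails in the almost everywhere sense. Take \<open>L = 1\<close>, \<open>\<Phi> = 0\<close>, \<open>X = x\<close>, and for
  \<open>T(t,s)\<close> the flow of the vector field \<open>w = 1 + c\<close> with \<open>c\<close> the Cantor function: \<open>T\<close> is jointly \<open>C\<^sup>1\<close>,
  \<open>dT/dt = w(T)/w(t)\<close> is locally constant in \<open>s\<close> near \<open>0\<close> for almost every \<open>t\<close>, yet the conserved
  quantity would be \<open>w\<close>.
\<close>

definition C1_family ::
    "real \<Rightarrow> real \<Rightarrow> real \<Rightarrow> (real \<Rightarrow> real ^ 'n \<Rightarrow> real ^ 'n \<Rightarrow> real \<Rightarrow> 'b::real_normed_vector) \<Rightarrow> bool" where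
  "C1_family a b \<epsilon> Y \<longleftrightarrow>
     C1_on (\<lambda>(t, x, v, s). Y t x v s) ({a..b} \<times> UNIV \<times> UNIV \<times> {-\<epsilon><..<\<epsilon>}) \<and>
     (\<exists>D. (\<forall>s\<in>{-\<epsilon><..<\<epsilon>}. \<forall>z\<in>{a..b} \<times> UNIV \<times> UNIV.
             ((\<lambda>(t, x, v). d_s Y t x v s) has_derivative blinfun_apply (D (z, s)))
               (at z within {a..b} \<times> UNIV \<times> UNIV))
        \<and> continuous_on (({a..b} \<times> UNIV \<times> UNIV) \<times> {-\<epsilon><..<\<epsilon>}) D)"

definition C1_transformations ::
    "real \<Rightarrow> real \<Rightarrow> real \<Rightarrow> (real \<Rightarrow> real ^ 'n \<Rightarrow> real ^ 'n \<Rightarrow> real \<Rightarrow> real)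
      \<Rightarrow> (real \<Rightarrow> real ^ 'n \<Rightarrow> real ^ 'n \<Rightarrow> real \<Rightarrow> real ^ 'n) \<Rightarrow> bool" where
  "C1_transformations a b \<epsilon> T X \<longleftrightarrow>
     C1_family a b \<epsilon> T \<and> C1_family a b \<epsilon> X \<and>
     (\<forall>t\<in>{a..b}. \<forall>x v. T t x v 0 = t \<and> X t x v 0 = x)"

text \<open>
  \<open>T\<close> may leave \<open>[a,b]\<close>, but for \<open>a < t < b\<close> the derivative at \<open>s = 0\<close> only involves \<open>L\<close> at
  times close to \<open>t\<close>, so the values of \<open>L\<close> outside \<open>[a,b]\<close> are irrelevant.
\<close>

definition quasi_invariant ::
    "real \<Rightarrow> real \<Rightarrow> real \<Rightarrow> (real \<Rightarrow> real ^ 'n \<Rightarrow> real ^ 'n \<Rightarrow> real)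
      \<Rightarrow> (real \<Rightarrow> real ^ 'n \<Rightarrow> real ^ 'n \<Rightarrow> real \<Rightarrow> real)
      \<Rightarrow> (real \<Rightarrow> real ^ 'n \<Rightarrow> real ^ 'n \<Rightarrow> real \<Rightarrow> real ^ 'n)
      \<Rightarrow> (real \<Rightarrow> real ^ 'n \<Rightarrow> real ^ 'n \<Rightarrow> real) \<Rightarrow> bool" where
  "quasi_invariant a b \<epsilon> L T X \<Phi> \<longleftrightarrow>
     (\<forall>x\<in>Lip a b.
        let Ts = (\<lambda>s. along a b x (\<lambda>t y v. T t y v s));
            Xs = (\<lambda>s. along a b x (\<lambda>t y v. X t y v s))
        in ddt_exists a b (along a b x \<Phi>)
         \<and> (\<forall>s\<in>{-\<epsilon><..<\<epsilon>}. ddt_exists a b (Ts s) \<and> ddt_exists a b (Xs s))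
         \<and> (AE t in lebesgue_on {a..b}.
              ((\<lambda>s. L (Ts s t) (Xs s t) (ddt a b (Xs s) t /\<^sub>R ddt a b (Ts s) t)
                     * ddt a b (Ts s) t)
                has_real_derivative ddt a b (along a b x \<Phi>) t) (at 0)))"

definition euler_lagrange ::
    "real \<Rightarrow> real \<Rightarrow> (real \<Rightarrow> real ^ 'n \<Rightarrow> real ^ 'n \<Rightarrow> real) \<Rightarrow> (real \<Rightarrow> real ^ 'n) \<Rightarrow> bool" where
  "euler_lagrange a b L x \<longleftrightarrow>
     ddt_exists a b (along a b x (L_v L)) \<and>
     (AE t in lebesgue_on {a..b}. ddt a b (along a b x (L_v L)) t = along a b x (L_x L) t)"

definition dubois_reymond ::
    "real \<Rightarrow> real \<Rightarrow> (real \<Rightarrow> real ^ 'n \<Rightarrow> real ^ 'n \<Rightarrow> real) \<Rightarrow> (real \<Rightarrow> real ^ 'n) \<Rightarrow> bool" where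
  "dubois_reymond a b L x \<longleftrightarrow>
     (let H = along a b x (\<lambda>t y v. L t y v - L_v L t y v \<bullet> v)
      in ddt_exists a b H \<and>
         (AE t in lebesgue_on {a..b}. along a b x (L_t a b L) t = ddt a b H t))"

end

theory Submission
  imports Defs
begin

text \<open>
  Write \<open>\<tau>\<close> and \<open>\<xi>\<close> for \<open>\<partial>T/\<partial>s\<close> and \<open>\<partial>X/\<partial>s\<close> at \<open>s = 0\<close> along the trajectory. At a
  time where the derivatives \<open>d/ds\<close> and \<open>d/dt\<close> may be interchanged, carrying out the differentiation in
  the definition of quasi-invariance gives
  \<open>d\<Phi>/dt = L\<^sub>t \<tau> + L\<^sub>x \<cdot> \<xi> + L\<^sub>v \<cdot> (\<xi>' - \<tau>' x') + L \<tau>'\<close>. By the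
  Euler-Lagrange equation and the DuBois-Reymond condition,
  \<open>L\<^sub>x\<close> is the derivative of \<open>L\<^sub>v\<close> and \<open>L\<^sub>t\<close> that of \<open>L - L\<^sub>v \<cdot> x'\<close>, and then the right-hand
  side is the derivative of \<open>(L - L\<^sub>v \<cdot> x') \<tau> + L\<^sub>v \<cdot> \<xi>\<close> by the product rule.
  
  The difficulty is regularity. The velocity of a Lipschitz trajectory is only measurable, so
  it is not clear that \<open>\<tau>\<close> and \<open>\<xi>\<close> have absolutely continuous representatives, and the null set where
  \<open>dT/dt\<close> fails to exist might depend on \<open>s\<close>. Both problems disappear because quasi-invariance
  is required along all Lipschitz trajectories: \<open>T\<close> and \<open>X\<close> must have a continuous
  representative even along a trajectory whose velocity jumps, which forces them not to depend on the
  velocity (\<open>velocity_independent\<close>). Along a Lipschitz trajectory \<open>\<tau>\<close> and \<open>\<xi>\<close> are then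
  Lipschitz, and the derivatives may be interchanged at every interior time where the trajectory is
  differentiable (\<open>C1_family_along\<close>, \<open>mixed_derivative_interchange\<close>).
  
  The conserved quantity thus agrees almost everywhere with an absolutely continuous function whose
  derivative vanishes almost everywhere, and such a function is constant
  (\<open>abs_cont_zero_deriv_imp_constant\<close>).
\<close>

section \<open>Absolutely continuous functions\<close>

text \<open>
  The families of intervals over which absolute continuity quantifies. They are pairs of endpoints
  that may touch, so only the open intervals have to be disjoint.
\<close>
definition nonoverlapping :: "real \<Rightarrow> real \<Rightarrow> (real \<times> real) set \<Rightarrow> bool" where
  "nonoverlapping a b D \<longleftrightarrow> finite D \<and> (\<forall>(u, v)\<in>D. a \<le> u \<and> u \<le> v \<and> v \<le> b)
     \<and> pairwise (\<lambda>(u, v) (u', v'). {u<..<v} \<inter> {u'<..<v'} = {}) D"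

lemma abs_cont_iff:
  "abs_cont a b F \<longleftrightarrow> (\<forall>e>0. \<exists>d>0. \<forall>D. nonoverlapping a b D \<and> (\<Sum>(u, v)\<in>D. v - u) < d
     \<longrightarrow> (\<Sum>(u, v)\<in>D. norm (F v - F u)) < e)"
  unfolding abs_cont_def nonoverlapping_def by (simp add: conj_assoc)

text \<open>
  Lipschitz functions, sums, differences and bounded bilinear products are all absolutely
  continuous by this one estimate on increments.
\<close>
lemma abs_cont_dominated:
  assumes F: "abs_cont a b F" and G: "abs_cont a b G"
    and le: "\<And>u v. a \<le> u \<Longrightarrow> u \<le> v \<Longrightarrow> v \<le> b \<Longrightarrow>
      norm (H v - H u) \<le> C * (norm (F v - F u) + norm (G v - G u))"
  shows "abs_cont a b H"
  unfolding abs_cont_iff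
proof (intro allI impI)
  fix e :: real assume "e > 0"
  define C' where "C' = max C 1"
  have C': "C' > 0" "C \<le> C'" by (auto simp: C'_def)
  have e': "e / (2 * C') > 0" using \<open>e > 0\<close> C' by simp
  obtain d1 where d1: "d1 > 0" "\<And>D. nonoverlapping a b D \<Longrightarrow> (\<Sum>(u, v)\<in>D. v - u) < d1
      \<Longrightarrow> (\<Sum>(u, v)\<in>D. norm (F v - F u)) < e / (2 * C')"
    using F e' unfolding abs_cont_iff by meson
  obtain d2 where d2: "d2 > 0" "\<And>D. nonoverlapping a b D \<Longrightarrow> (\<Sum>(u, v)\<in>D. v - u) < d2
      \<Longrightarrow> (\<Sum>(u, v)\<in>D. norm (G v - G u)) < e / (2 * C')"
    using G e' unfolding abs_cont_iff by meson
  show "\<exists>d>0. \<forall>D. nonoverlapping a b D \<and> (\<Sum>(u, v)\<in>D. v - u) < d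
     \<longrightarrow> (\<Sum>(u, v)\<in>D. norm (H v - H u)) < e"
  proof (intro exI[of _ "min d1 d2"] conjI allI impI)
    show "min d1 d2 > 0" using d1 d2 by simp
    fix D assume D: "nonoverlapping a b D \<and> (\<Sum>(u, v)\<in>D. v - u) < min d1 d2"
    have "(\<Sum>(u, v)\<in>D. norm (H v - H u))
        \<le> (\<Sum>(u, v)\<in>D. C' * (norm (F v - F u) + norm (G v - G u)))"
    proof (rule sum_mono, clarify)
      fix u v assume "(u, v) \<in> D"
      then have "a \<le> u" "u \<le> v" "v \<le> b" using D by (auto simp: nonoverlapping_def)
      then have "norm (H v - H u) \<le> C * (norm (F v - F u) + norm (G v - G u))" by (rule le)
      also have "\<dots> \<le> C' * (norm (F v - F u) + norm (G v - G u))"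
        using C' by (intro mult_right_mono) auto
      finally show "norm (H v - H u) \<le> C' * (norm (F v - F u) + norm (G v - G u))" .
    qed
    also have "\<dots> = C' * ((\<Sum>(u, v)\<in>D. norm (F v - F u)) + (\<Sum>(u, v)\<in>D. norm (G v - G u)))"
      by (simp add: sum_distrib_left sum.distrib[symmetric] case_prod_unfold distrib_left)
    also have "\<dots> < C' * (e / (2 * C') + e / (2 * C'))"
      using d1(2)[of D] d2(2)[of D] D C' by (intro mult_strict_left_mono add_strict_mono) auto
    also have "\<dots> = e" using C' by (simp add: field_simps)
    finally show "(\<Sum>(u, v)\<in>D. norm (H v - H u)) < e" .
  qed
qed

lemma abs_cont_lipschitz:
  assumes "C-lipschitz_on {a..b} F"
  shows "abs_cont a b F"
proof -
  have "abs_cont a b (\<lambda>t::real. t)"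
    unfolding abs_cont_iff
  proof (intro allI impI)
    fix e :: real assume "e > 0"
    moreover have "(\<Sum>(u, v)\<in>D. norm (v - u)) = (\<Sum>(u, v)\<in>D. v - u)" if "nonoverlapping a b D" for D
      using that by (intro sum.cong) (auto simp: nonoverlapping_def)
    ultimately show "\<exists>d>0. \<forall>D. nonoverlapping a b D \<and> (\<Sum>(u, v)\<in>D. v - u) < d
      \<longrightarrow> (\<Sum>(u, v)\<in>D. norm (v - u)) < e" by auto
  qed
  then show ?thesis
  proof (rule abs_cont_dominated[where C = C])
    show "abs_cont a b (\<lambda>t::real. t)" by fact
    fix u v assume uv: "a \<le> u" "u \<le> v" "v \<le> b"
    then have "norm (F v - F u) \<le> C * norm (v - u)"
      using lipschitz_on_normD[OF assms, of v u] by auto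
    also have "\<dots> \<le> C * (norm (v - u) + norm (v - u))"
      using lipschitz_on_nonneg[OF assms] by (intro mult_left_mono) auto
    finally show "norm (F v - F u) \<le> C * (norm (v - u) + norm (v - u))" .
  qed
qed

lemma abs_cont_add:
  assumes "abs_cont a b F" "abs_cont a b G"
  shows "abs_cont a b (\<lambda>t. F t + G t)"
  using assms by (rule abs_cont_dominated[where C = 1]) (simp add: add_diff_add norm_triangle_ineq)

lemma abs_cont_diff:
  assumes "abs_cont a b F" "abs_cont a b G"
  shows "abs_cont a b (\<lambda>t. F t - G t)"
  using assms
proof (rule abs_cont_dominated[where C = 1])
  fix u v
  have "F v - G v - (F u - G u) = (F v - F u) - (G v - G u)" by simp
  then show "norm (F v - G v - (F u - G u)) \<le> 1 * (norm (F v - F u) + norm (G v - G u))"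
    by (metis mult_1 norm_triangle_ineq4)
qed

lemma abs_cont_imp_continuous_on:
  assumes "abs_cont a b F"
  shows "continuous_on {a..b} F"
  unfolding continuous_on_iff
proof (intro ballI allI impI)
  fix t e :: real assume t: "t \<in> {a..b}" and "e > 0"
  then obtain d where d: "d > 0" "\<And>D. nonoverlapping a b D \<Longrightarrow> (\<Sum>(u, v)\<in>D. v - u) < d
      \<Longrightarrow> (\<Sum>(u, v)\<in>D. norm (F v - F u)) < e"
    using assms unfolding abs_cont_iff by meson
  have "dist (F s) (F t) < e" if s: "s \<in> {a..b}" "dist s t < d" for s
    using d(2)[of "{(min s t, max s t)}"] s t
    by (cases "s \<le> t") (auto simp: nonoverlapping_def dist_norm min_def max_def norm_minus_commute)
  then show "\<exists>d>0. \<forall>s\<in>{a..b}. dist s t < d \<longrightarrow> dist (F s) (F t) < e"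
    using d(1) by blast
qed

text \<open>
  The Leibniz splitting \<open>p(F,G)(v) - p(F,G)(u) = p(F v - F u, G v) + p(F u, G v - G u)\<close> and the
  boundedness of \<open>F\<close> and \<open>G\<close> on the compact interval dominate the increments of the product.
\<close>
lemma abs_cont_bilinear:
  assumes "bounded_bilinear p" and F: "abs_cont a b F" and G: "abs_cont a b G"
  shows "abs_cont a b (\<lambda>t. p (F t) (G t))"
proof -
  interpret bounded_bilinear p by fact
  obtain K where K: "K > 0" "\<And>y z. norm (p y z) \<le> norm y * norm z * K"
    using pos_bounded by blast
  have "bounded (F ` {a..b})"
    by (intro compact_imp_bounded compact_continuous_image abs_cont_imp_continuous_on F) simp
  then obtain B1 where B1: "\<And>t. t \<in> {a..b} \<Longrightarrow> norm (F t) \<le> B1" unfolding bounded_iff by blast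
  have "bounded (G ` {a..b})"
    by (intro compact_imp_bounded compact_continuous_image abs_cont_imp_continuous_on G) simp
  then obtain B2 where B2: "\<And>t. t \<in> {a..b} \<Longrightarrow> norm (G t) \<le> B2" unfolding bounded_iff by blast
  define M where "M = max B1 B2"
  show ?thesis
    using F G
  proof (rule abs_cont_dominated[where C = "M * K"])
    fix u v assume "a \<le> u" "u \<le> v" "v \<le> b"
    then have M: "norm (F u) \<le> M" "norm (G v) \<le> M" using B1[of u] B2[of v] by (auto simp: M_def)
    have "p (F v) (G v) - p (F u) (G u) = p (F v - F u) (G v) + p (F u) (G v - G u)"
      by (simp add: diff_left diff_right)
    then have "norm (p (F v) (G v) - p (F u) (G u))
        \<le> norm (F v - F u) * norm (G v) * K + norm (F u) * norm (G v - G u) * K"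
      by (simp add: norm_triangle_le add_mono K(2))
    also have "\<dots> \<le> norm (F v - F u) * M * K + M * norm (G v - G u) * K"
      using M K(1) by (intro add_mono mult_right_mono mult_left_mono) auto
    finally show "norm (p (F v) (G v) - p (F u) (G u))
        \<le> M * K * (norm (F v - F u) + norm (G v - G u))"
      by (simp add: algebra_simps)
  qed
qed

lemma abs_cont_subinterval:
  assumes "abs_cont a b F" "c \<le> b"
  shows "abs_cont a c F"
proof -
  have "nonoverlapping a b D" if "nonoverlapping a c D" for D
    using that assms(2) by (fastforce simp: nonoverlapping_def)
  then show ?thesis using assms(1) unfolding abs_cont_iff by meson
qed

lemma nonoverlapping_length_le:
  assumes D: "nonoverlapping a b D" and U: "U \<in> lmeasurable"
    and sub: "\<And>u v. (u, v) \<in> D \<Longrightarrow> {u<..<v} \<subseteq> U"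
  shows "(\<Sum>(u, v)\<in>D. v - u) \<le> measure lebesgue U"
proof -
  let ?I = "\<lambda>(u::real, v). {u<..<v}"
  have fin: "finite D" and le: "\<And>u v. (u, v) \<in> D \<Longrightarrow> u \<le> v"
    using D by (auto simp: nonoverlapping_def)
  have m: "?I p \<in> lmeasurable" for p
    by (cases p) (auto intro!: bounded_set_imp_lmeasurable)
  have "(\<Sum>(u, v)\<in>D. v - u) = (\<Sum>p\<in>D. measure lebesgue (?I p))"
    using le by (intro sum.cong) auto
  also have "\<dots> = measure lebesgue (\<Union>(?I ` D))"
    by (rule measure_negligible_finite_Union_image[OF fin m, symmetric])
       (use D in \<open>fastforce simp: nonoverlapping_def pairwise_def\<close>)
  also have "\<dots> \<le> measure lebesgue U"
    using sub fin m U by (intro measure_mono_fmeasurable) (auto intro!: sets.finite_UN fmeasurableD)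
  finally show ?thesis .
qed

text \<open>
  Cousin's lemma replaces the Vitali covering argument. Around a point outside the null set the
  gauge makes the increments of \<open>F\<close> at most \<open>e1\<close> times the length; around a point of the null
  set it keeps the intervals inside an open set \<open>U\<close> of small measure. In a fine tagged division
  the intervals of the first kind contribute at most \<open>e1 (b - a)\<close> to \<open>F b - F a\<close>, and those
  of the second kind have small total length, so that absolute continuity bounds their
  contribution.
\<close>
lemma abs_cont_zero_deriv_endpoints:
  fixes F :: "real \<Rightarrow> 'a::real_normed_vector"
  assumes F: "abs_cont a b F" and "a \<le> b" and N: "negligible N"
    and der: "\<And>t. t \<in> {a..b} - N \<Longrightarrow> (F has_vector_derivative 0) (at t within {a..b})"
  shows "F b = F a"
proof -
  have "norm (F b - F a) \<le> 0 + e" if "e > 0" for e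
  proof -
    define e1 where "e1 = e / (2 * (b - a + 1))"
    have e1: "e1 > 0" "e1 * (b - a) \<le> e / 2"
      using \<open>e > 0\<close> \<open>a \<le> b\<close> by (auto simp: e1_def field_simps)
    obtain d where d: "d > 0" "\<And>D. nonoverlapping a b D \<Longrightarrow> (\<Sum>(u, v)\<in>D. v - u) < d
      \<Longrightarrow> (\<Sum>(u, v)\<in>D. norm (F v - F u)) < e / 2"
      using F \<open>e > 0\<close> unfolding abs_cont_iff by (meson half_gt_zero)
    obtain U where U: "open U" "N \<subseteq> U" "U \<in> lmeasurable" "measure lebesgue U < d"
    proof -
      have "N \<in> sets lebesgue" using N by (rule negligible_imp_sets)
      then obtain U where U: "open U" "N \<subseteq> U" "U - N \<in> lmeasurable" "emeasure lebesgue (U - N) < ennreal d"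
        by (rule sets_lebesgue_outer_open[OF _ d(1)])
      have null: "N \<in> null_sets lebesgue" using N by (simp add: negligible_iff_null_sets)
      have "U \<in> lmeasurable"
        using fmeasurable.Un[OF U(3) negligible_imp_measurable[OF N]] U(2) by (simp add: Un_absorb2)
      moreover have "measure lebesgue (U - N) = measure lebesgue U"
        using calculation null by (intro measure_Diff_null_set) (auto dest: fmeasurableD)
      moreover have "measure lebesgue (U - N) < d"
        using U(4) unfolding emeasure_eq_measure2[OF U(3)] by (subst (asm) ennreal_less_iff) auto
      ultimately show ?thesis using U that by simp
    qed
    define Q where "Q t r \<longleftrightarrow> r > 0 \<and> (t \<in> N \<longrightarrow> ball t r \<subseteq> U) \<and> (t \<in> {a..b} - N \<longrightarrow>
        (\<forall>s\<in>{a..b}. \<bar>s - t\<bar> < r \<longrightarrow> norm (F s - F t) \<le> e1 * \<bar>s - t\<bar>))" for t r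
    have "\<exists>r. Q t r" for t
    proof (cases "t \<in> N")
      case True
      then show ?thesis using open_contains_ball_eq[OF U(1)] U(2) unfolding Q_def by blast
    next
      case False
      show ?thesis
      proof (cases "t \<in> {a..b}")
        case True
        then have "(F has_derivative (\<lambda>h. h *\<^sub>R 0)) (at t within {a..b})"
          using der[of t] False by (simp add: has_vector_derivative_def)
        then have "\<exists>r>0. \<forall>s\<in>{a..b}. norm (s - t) < r \<longrightarrow>
            norm (F s - F t - (s - t) *\<^sub>R 0) \<le> e1 * norm (s - t)"
          using e1(1) unfolding has_derivative_within_alt by blast
        then show ?thesis using False unfolding Q_def by auto
      qed (use False in \<open>auto simp: Q_def intro: exI[of _ 1]\<close>)
    qed
    then obtain r where "\<And>t. Q t (r t)" by metis
    then have r: "\<And>t. r t > 0" "\<And>t. t \<in> N \<Longrightarrow> ball t (r t) \<subseteq> U"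
      "\<And>t s. t \<in> {a..b} \<Longrightarrow> t \<notin> N \<Longrightarrow> s \<in> {a..b} \<Longrightarrow> \<bar>s - t\<bar> < r t \<Longrightarrow> norm (F s - F t) \<le> e1 * \<bar>s - t\<bar>"
      unfolding Q_def by (blast, blast, simp)
    have "gauge (\<lambda>t. ball t (r t))" using r(1) by (intro gauge_ball_dependent) auto
    then obtain p where p: "p tagged_division_of {a..b}" "(\<lambda>t. ball t (r t)) fine p"
      using fine_division_exists_real by blast
    have fin: "finite p" using p(1) by blast
    have K: "t \<in> {Inf K..Sup K}" "K = {Inf K..Sup K}" "a \<le> Inf K" "Inf K \<le> Sup K" "Sup K \<le> b"
      "K \<subseteq> ball t (r t)" if tK: "(t, K) \<in> p" for t K
    proof -
      obtain u v where uv: "K = {u..v}" using tagged_division_ofD(4)[OF p(1) tK] by auto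
      have "t \<in> K" "K \<subseteq> {a..b}" using tagged_division_ofD(2,3)[OF p(1) tK] by auto
      then show "t \<in> {Inf K..Sup K}" "K = {Inf K..Sup K}" "a \<le> Inf K" "Inf K \<le> Sup K" "Sup K \<le> b"
        using uv by auto
      show "K \<subseteq> ball t (r t)" using p(2) tK by (auto simp: fine_def)
    qed
    define q where "q = {(t, K) \<in> p. t \<in> N}"
    have q: "q \<subseteq> p" "finite q" using fin by (auto simp: q_def intro: rev_finite_subset)
    let ?g = "\<lambda>(t::real, K::real set). (Inf K, Sup K)"
    have nol: "nonoverlapping a b (?g ` q)"
      unfolding nonoverlapping_def
    proof (intro conjI)
      show "finite (?g ` q)" using q by simp
      show "\<forall>(u, v)\<in>?g ` q. a \<le> u \<and> u \<le> v \<and> v \<le> b" using K q(1) by fastforce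
      have "{Inf K1<..<Sup K1} \<inter> {Inf K2<..<Sup K2} = {}"
        if *: "(t1, K1) \<in> q" "(t2, K2) \<in> q" "(Inf K1, Sup K1) \<noteq> (Inf K2, Sup K2)" for t1 K1 t2 K2
      proof -
        have "(t1, K1) \<noteq> (t2, K2)" using * by auto
        then have "interior K1 \<inter> interior K2 = {}"
          using tagged_division_ofD(5)[OF p(1)] * q(1) by blast
        moreover have "interior K1 = {Inf K1<..<Sup K1}" "interior K2 = {Inf K2<..<Sup K2}"
          using K(2)[of t1 K1] K(2)[of t2 K2] * q(1) by (metis interior_atLeastAtMost_real subsetD)+
        ultimately show ?thesis by simp
      qed
      then show "pairwise (\<lambda>(u, v) (u', v'). {u<..<v} \<inter> {u'<..<v'} = {}) (?g ` q)"
        unfolding pairwise_def by (auto simp del: greaterThanLessThan_iff)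
    qed
    have "(\<Sum>(u, v)\<in>?g ` q. v - u) \<le> measure lebesgue U"
    proof (rule nonoverlapping_length_le[OF nol U(3)])
      fix u v assume "(u, v) \<in> ?g ` q"
      then obtain t K' where tK: "(t, K') \<in> q" "u = Inf K'" "v = Sup K'" by auto
      then have "K' \<subseteq> U" using K(6)[of t K'] q(1) r(2)[of t] by (auto simp: q_def)
      then show "{u<..<v} \<subseteq> U" using K(2)[of t K'] tK q(1)
        by (metis greaterThanLessThan_subseteq_atLeastAtMost_iff order.refl order.trans subsetD)
    qed
    then have small: "(\<Sum>(u, v)\<in>?g ` q. norm (F v - F u)) < e / 2"
      using U(4) by (intro d(2)[OF nol]) simp
    have "(\<Sum>(u, v)\<in>?g ` q. norm (F v - F u)) = (\<Sum>(t, K)\<in>q. norm (F (Sup K) - F (Inf K)))"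
    proof (subst sum.reindex_nontrivial)
      show "finite q" by fact
      \<comment> \<open>Distinct members of a tagged division have disjoint interiors. If they share their
        endpoints, then they are degenerate and the increment of \<open>F\<close> vanishes.\<close>
      fix P Q assume PQ: "P \<in> q" "Q \<in> q" "P \<noteq> Q" "?g P = ?g Q"
      obtain t1 K1 t2 K2 where [simp]: "P = (t1, K1)" "Q = (t2, K2)" by (cases P, cases Q)
      have "K1 = K2" using K(2)[of t1 K1] K(2)[of t2 K2] PQ q(1) by auto
      then have "interior K1 = {}"
        using tagged_division_ofD(5)[OF p(1), of t1 K1 t2 K2] PQ q(1) by auto
      then have "{Inf K1<..<Sup K1} = {}"
        using K(2)[of t1 K1] PQ q(1) by (metis \<open>P = (t1, K1)\<close> interior_atLeastAtMost_real subsetD)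
      then have "Inf K1 = Sup K1" using K(4)[of t1 K1] PQ q(1) by auto
      then show "(case ?g P of (u, v) \<Rightarrow> norm (F v - F u)) = 0" by simp
    qed (auto simp: case_prod_unfold)
    with small have s1: "(\<Sum>(t, K)\<in>q. norm (F (Sup K) - F (Inf K))) < e / 2" by simp
    have "(\<Sum>(t, K)\<in>p - q. norm (F (Sup K) - F (Inf K))) \<le> (\<Sum>(t, K)\<in>p - q. e1 * (Sup K - Inf K))"
    proof (rule sum_mono, clarify)
      fix t K' assume tK: "(t, K') \<in> p" "(t, K') \<notin> q"
      note K' = K[OF tK(1)]
      have t: "t \<notin> N" "t \<in> {a..b}" using tK K'(1,3,5) by (auto simp: q_def)
      have in_ball: "\<bar>s - t\<bar> < r t" if "s \<in> {Inf K'..Sup K'}" for s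
        using K'(2,6) that by (auto simp: dist_real_def abs_minus_commute)
      have "norm (F (Sup K') - F t) \<le> e1 * \<bar>Sup K' - t\<bar>" "norm (F (Inf K') - F t) \<le> e1 * \<bar>Inf K' - t\<bar>"
        using in_ball[of "Sup K'"] in_ball[of "Inf K'"] K'(3-5)
        by (auto intro!: r(3)[OF t(2,1)])
      moreover have "norm (F (Sup K') - F (Inf K')) \<le> norm (F (Sup K') - F t) + norm (F (Inf K') - F t)"
        using norm_triangle_ineq4[of "F (Sup K') - F t" "F (Inf K') - F t"] by simp
      moreover have "\<bar>Sup K' - t\<bar> + \<bar>Inf K' - t\<bar> = Sup K' - Inf K'" using K'(1) by auto
      ultimately show "norm (F (Sup K') - F (Inf K')) \<le> e1 * (Sup K' - Inf K')"
        by (smt (verit) distrib_left)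
    qed
    also have "\<dots> \<le> (\<Sum>(t, K)\<in>p. e1 * (Sup K - Inf K))"
      using fin e1(1) K(4) by (intro sum_mono2) auto
    also have "\<dots> = e1 * (b - a)"
      using additive_tagged_division_1[OF \<open>a \<le> b\<close> p(1), of "\<lambda>t. t"]
      by (simp add: sum_distrib_left[symmetric] case_prod_unfold)
    also have "\<dots> \<le> e / 2" by (rule e1(2))
    finally have s2: "(\<Sum>(t, K)\<in>p - q. norm (F (Sup K) - F (Inf K))) \<le> e / 2" .
    have "norm (F b - F a) = norm (\<Sum>(t, K)\<in>p. F (Sup K) - F (Inf K))"
      using additive_tagged_division_1[OF \<open>a \<le> b\<close> p(1), of F] by simp
    also have "\<dots> \<le> (\<Sum>(t, K)\<in>p. norm (F (Sup K) - F (Inf K)))"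
      using norm_sum[of "\<lambda>(t, K). F (Sup K) - F (Inf K)" p] by (simp add: case_prod_unfold)
    also have "\<dots> = (\<Sum>(t, K)\<in>p - q. norm (F (Sup K) - F (Inf K))) + (\<Sum>(t, K)\<in>q. norm (F (Sup K) - F (Inf K)))"
      by (rule sum.subset_diff[OF q(1) fin])
    finally show "norm (F b - F a) \<le> 0 + e" using s1 s2 by simp
  qed
  then have "norm (F b - F a) \<le> 0" by (rule field_le_epsilon)
  then show ?thesis by simp
qed

lemma AE_lebesgue_on_interval:
  "(AE t in lebesgue_on {a..b}. P t) \<longleftrightarrow> negligible {t\<in>{a..b::real}. \<not> P t}"
proof -
  have "(AE t in lebesgue_on {a..b}. P t) \<longleftrightarrow> (AE t in lebesgue. t \<in> {a..b} \<longrightarrow> P t)"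
    by (rule AE_restrict_space_iff) auto
  also have "\<dots> \<longleftrightarrow> {t \<in> space lebesgue. \<not> (t \<in> {a..b} \<longrightarrow> P t)} \<in> null_sets lebesgue"
    by (rule completion.AE_iff_null_sets)
  also have "{t \<in> space lebesgue. \<not> (t \<in> {a..b} \<longrightarrow> P t)} = {t\<in>{a..b}. \<not> P t}" by auto
  finally show ?thesis unfolding negligible_iff_null_sets .
qed

lemma abs_cont_zero_deriv_imp_constant:
  fixes F :: "real \<Rightarrow> 'a::real_normed_vector"
  assumes F: "abs_cont a b F" 
    and der: "AE t in lebesgue_on {a..b}. (F has_vector_derivative 0) (at t within {a..b})"
    and t: "t \<in> {a..b}"
  shows "F t = F a"
proof (rule abs_cont_zero_deriv_endpoints)
  show "abs_cont a t F" using F t by (auto intro: abs_cont_subinterval)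
  show "a \<le> t" using t by simp
  show "negligible {t\<in>{a..b}. \<not> (F has_vector_derivative 0) (at t within {a..b})}"
    using der by (simp only: AE_lebesgue_on_interval)
  show "(F has_vector_derivative 0) (at s within {a..t})"
    if "s \<in> {a..t} - {t\<in>{a..b}. \<not> (F has_vector_derivative 0) (at t within {a..b})}" for s
    using that t by (auto intro: has_vector_derivative_within_subset[where S = "{a..b}"])
qed

section \<open>The derivative of an almost everywhere defined function\<close>

text \<open>
  The set where \<open>f\<close> and \<open>g\<close> agree is closed, and a closed set that contains almost every point of
  an open interval contains the whole interval.
\<close>
lemma continuous_on_AE_eq:
  fixes f g :: "real \<Rightarrow> 'a::real_normed_vector"
  assumes "a < b" and f: "continuous_on {a..b} f" and g: "continuous_on {a..b} g"
    and eq: "AE t in lebesgue_on {a..b}. f t = g t" and t: "t \<in> {a..b}"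
  shows "f t = g t"
proof -
  let ?C = "{t\<in>{a..b}. f t = g t}"
  have C: "closed ?C"
    using continuous_closed_preimage_constant[of "{a..b}" "\<lambda>t. f t - g t" 0] f g
    by (simp add: continuous_on_diff)
  have "AE t in lebesgue. t \<in> {a..b} \<longrightarrow> f t = g t"
    using eq by (subst (asm) AE_restrict_space_iff) auto
  then have "AE t\<in>{a<..<b} in lebesgue. t \<in> ?C" by eventually_elim auto
  then have "{a<..<b} \<subseteq> ?C"
    using mem_closed_if_AE_lebesgue_open[OF open_greaterThanLessThan C] by blast
  then have "closure {a<..<b} \<subseteq> ?C" using C by (rule closure_minimal)
  then show ?thesis using t \<open>a < b\<close> by auto
qed

lemma AE_lebesgue_on_subinterval:
  assumes "AE t in lebesgue_on {a..b}. P t" "{c..d} \<subseteq> {a..b}"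
  shows "AE t in lebesgue_on {c..d::real}. t \<noteq> e \<and> P t"
proof -
  have "{t\<in>{c..d}. \<not> (t \<noteq> e \<and> P t)} \<subseteq> insert e {t\<in>{a..b}. \<not> P t}" using assms(2) by auto
  then show ?thesis
    using assms(1) unfolding AE_lebesgue_on_interval by (meson negligible_insert negligible_subset)
qed

text \<open>
  Two representatives agree almost everywhere and are continuous, hence agree on all of
  \<open>[a,b]\<close>. The choice made in \<open>ddt\<close> therefore does not matter there.
\<close>
lemma ac_rep_unique:
  assumes "a < b" "ac_rep a b f F" "ac_rep a b f G" "t \<in> {a..b}"
  shows "F t = G t"
proof (rule continuous_on_AE_eq[OF \<open>a < b\<close> _ _ _ assms(4)])
  show "continuous_on {a..b} F" "continuous_on {a..b} G"
    using assms by (auto simp: ac_rep_def intro: abs_cont_imp_continuous_on)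
  have "AE t in lebesgue_on {a..b}. f t = F t" "AE t in lebesgue_on {a..b}. f t = G t"
    using assms(2,3) by (auto simp: ac_rep_def)
  then show "AE t in lebesgue_on {a..b}. F t = G t" by eventually_elim simp
qed

lemma ddt_exists_representative:
  assumes "a < b" "ddt_exists a b f"
  obtains F where "abs_cont a b F" "AE t in lebesgue_on {a..b}. f t = F t"
    "AE t in lebesgue_on {a..b}. (F has_vector_derivative ddt a b f t) (at t within {a..b})"
proof -
  obtain G where G: "ac_rep a b f G" "AE t in lebesgue_on {a..b}. G differentiable (at t within {a..b})"
    using assms(2) by (auto simp: ddt_exists_def)
  define F where "F = (SOME F. ac_rep a b f F)"
  have F: "ac_rep a b f F" using G(1) unfolding F_def by (rule someI[of "ac_rep a b f"])
  have "AE t in lebesgue_on {a..b}. (F has_vector_derivative ddt a b f t) (at t within {a..b})"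
    using G(2)
  proof (rule lebesgue_on_mono)
    fix t assume t: "G differentiable (at t within {a..b})" "t \<in> {a..b}"
    have "F differentiable (at t within {a..b})"
      by (rule differentiable_transform_within[OF t(1) zero_less_one t(2)])
         (use ac_rep_unique[OF \<open>a < b\<close> G(1) F] in auto)
    then show "(F has_vector_derivative ddt a b f t) (at t within {a..b})"
      by (simp add: ddt_def F_def vector_derivative_works)
  qed
  with F show ?thesis by (intro that[of F]) (auto simp: ac_rep_def)
qed

lemma ddt_of_continuous:
  assumes "a < b" "ddt_exists a b f" and f: "continuous_on {a..b} f"
  shows "AE t in lebesgue_on {a..b}. f differentiable (at t within {a..b})"
    and "\<And>t f'. t \<in> {a..b} \<Longrightarrow> (f has_vector_derivative f') (at t within {a..b}) \<Longrightarrow> ddt a b f t = f'"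
proof -
  obtain G where G: "ac_rep a b f G" "AE t in lebesgue_on {a..b}. G differentiable (at t within {a..b})"
    using assms(2) by (auto simp: ddt_exists_def)
  have eq: "F t = f t" if "ac_rep a b f F" "t \<in> {a..b}" for F t
  proof (rule continuous_on_AE_eq[OF \<open>a < b\<close> _ f _ that(2)])
    show "continuous_on {a..b} F"
      using that by (auto simp: ac_rep_def intro: abs_cont_imp_continuous_on)
    show "AE t in lebesgue_on {a..b}. F t = f t" using that by (auto simp: ac_rep_def eq_commute)
  qed
  show "AE t in lebesgue_on {a..b}. f differentiable (at t within {a..b})"
    using G(2)
  proof (rule lebesgue_on_mono)
    fix t assume t: "G differentiable (at t within {a..b})" "t \<in> {a..b}"
    show "f differentiable (at t within {a..b})"
      by (rule differentiable_transform_within[OF t(1) zero_less_one t(2)]) (use eq[OF G(1)] in auto)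
  qed
  fix t f' assume t: "t \<in> {a..b}" and f': "(f has_vector_derivative f') (at t within {a..b})"
  define F where "F = (SOME F. ac_rep a b f F)"
  have F: "ac_rep a b f F" using G(1) unfolding F_def by (rule someI[of "ac_rep a b f"])
  have "(F has_vector_derivative f') (at t within {a..b})"
    by (rule has_vector_derivative_transform[OF t _ f']) (use eq[OF F] in auto)
  then show "ddt a b f t = f'"
    unfolding ddt_def F_def[symmetric] using vector_derivative_within_cbox[of a b t F f'] \<open>a < b\<close> t by simp
qed

section \<open>Quasi-invariance removes the dependence on the velocity\<close>

text \<open>
  Test trajectories for the next lemma: they pass through \<open>y0\<close> at time \<open>t0\<close>, where their velocity
  jumps from \<open>v1\<close> to \<open>v2\<close>.
\<close>
lemma kinked_trajectory:
  fixes y0 v1 v2 :: "real ^ 'n" and t0 :: real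
  assumes "a < b"
  defines "y \<equiv> \<lambda>t::real. y0 + min (t - t0) 0 *\<^sub>R v1 + max (t - t0) 0 *\<^sub>R v2"
  shows "y \<in> Lip a b"
    and "\<And>t. t \<in> {a..b} \<Longrightarrow> t < t0 \<Longrightarrow> velocity a b y t = v1"
    and "\<And>t. t \<in> {a..b} \<Longrightarrow> t0 < t \<Longrightarrow> velocity a b y t = v2"
proof -
  have "(norm v1 + norm v2)-lipschitz_on {a..b} y"
  proof (rule lipschitz_onI)
    fix s t
    have "y s - y t = (min (s - t0) 0 - min (t - t0) 0) *\<^sub>R v1 + (max (s - t0) 0 - max (t - t0) 0) *\<^sub>R v2"
      by (simp add: y_def algebra_simps)
    then have "norm (y s - y t) \<le> \<bar>min (s - t0) 0 - min (t - t0) 0\<bar> * norm v1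
        + \<bar>max (s - t0) 0 - max (t - t0) 0\<bar> * norm v2"
      by (metis norm_scaleR norm_triangle_ineq)
    also have "\<dots> \<le> \<bar>s - t\<bar> * norm v1 + \<bar>s - t\<bar> * norm v2"
      by (intro add_mono mult_right_mono) auto
    finally show "dist (y s) (y t) \<le> (norm v1 + norm v2) * dist s t"
      by (simp add: dist_norm algebra_simps)
  qed auto
  then show "y \<in> Lip a b" by (auto simp: Lip_def)
  show "velocity a b y t = v1" if t: "t \<in> {a..b}" "t < t0" for t
  proof -
    have "((\<lambda>t. y0 + (t - t0) *\<^sub>R v1) has_vector_derivative v1) (at t)"
      by (auto intro!: derivative_eq_intros)
    then have "(y has_vector_derivative v1) (at t)"
      by (rule has_vector_derivative_transform_within_open[of _ _ _ "{..<t0}"]) (use t in \<open>auto simp: y_def\<close>)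
    then have "(y has_vector_derivative v1) (at t within {a..b})" by (rule has_vector_derivative_at_within)
    then show ?thesis
      unfolding velocity_def using vector_derivative_within_cbox[of a b t y v1] t(1) \<open>a < b\<close> by simp
  qed
  show "velocity a b y t = v2" if t: "t \<in> {a..b}" "t0 < t" for t
  proof -
    have "((\<lambda>t. y0 + (t - t0) *\<^sub>R v2) has_vector_derivative v2) (at t)"
      by (auto intro!: derivative_eq_intros)
    then have "(y has_vector_derivative v2) (at t)"
      by (rule has_vector_derivative_transform_within_open[of _ _ _ "{t0<..}"]) (use t in \<open>auto simp: y_def\<close>)
    then have "(y has_vector_derivative v2) (at t within {a..b})" by (rule has_vector_derivative_at_within)
    then show ?thesis
      unfolding velocity_def using vector_derivative_within_cbox[of a b t y v2] t(1) \<open>a < b\<close> by simp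
  qed
qed

text \<open>
  Evaluated along the kinked trajectory and its velocity, \<open>f\<close> tends to \<open>f t0 y0 v1\<close> from the left of \<open>t0\<close> and to
  \<open>f t0 y0 v2\<close> from the right. A function that has a continuous representative cannot jump, so both
  values coincide. The endpoints of the interval follow by continuity of \<open>f\<close> in time.
\<close>
lemma velocity_independent:
  fixes f :: "real \<Rightarrow> real ^ 'n \<Rightarrow> real ^ 'n \<Rightarrow> 'b::real_normed_vector"
  assumes "a < b" and cont: "continuous_on ({a..b} \<times> UNIV \<times> UNIV) (\<lambda>(t, x, v). f t x v)"
    and ex: "\<And>y. y \<in> Lip a b \<Longrightarrow> ddt_exists a b (along a b y f)"
    and t: "t \<in> {a..b}"
  shows "f t y0 v1 = f t y0 v2"
proof -
  have cont': "continuous_on S (\<lambda>t. f t (p t) v)" if "continuous_on S p" "S \<subseteq> {a..b}" for S p v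
    using continuous_on_compose2[OF cont, of S "\<lambda>t. (t, p t, v)"] that
    by (force intro!: continuous_intros)
  have "f t0 y0 v1 = f t0 y0 v2" if t0: "t0 \<in> {a<..<b}" for t0
  proof -
    define y where "y t = y0 + min (t - t0) 0 *\<^sub>R v1 + max (t - t0) 0 *\<^sub>R v2" for t
    note y = kinked_trajectory[OF \<open>a < b\<close>, where ?y0.0 = y0 and ?t0.0 = t0 and ?v1.0 = v1 and ?v2.0 = v2,
        folded y_def]
    have cy: "continuous_on S y" for S unfolding y_def by (intro continuous_intros)
    obtain F where F: "abs_cont a b F" and AE: "AE t in lebesgue_on {a..b}. along a b y f t = F t"
      using ex[OF y(1)] ddt_exists_representative[OF \<open>a < b\<close>] by metis
    have cF: "continuous_on {a..b} F" using F by (rule abs_cont_imp_continuous_on)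
    have "F t0 = f t0 (y t0) v1"
    proof (rule continuous_on_AE_eq[where a = a and b = t0])
      show "AE t in lebesgue_on {a..t0}. F t = f t (y t) v1"
        by (rule lebesgue_on_mono[OF AE_lebesgue_on_subinterval[OF AE, of a t0 t0]])
           (use t0 y(2) in \<open>auto simp: along_def\<close>)
    qed (use t0 cont'[OF cy] cF in \<open>auto intro: continuous_on_subset\<close>)
    moreover have "F t0 = f t0 (y t0) v2"
    proof (rule continuous_on_AE_eq[where a = t0 and b = b])
      show "AE t in lebesgue_on {t0..b}. F t = f t (y t) v2"
        by (rule lebesgue_on_mono[OF AE_lebesgue_on_subinterval[OF AE, of t0 b t0]])
           (use t0 y(3) in \<open>auto simp: along_def\<close>)
    qed (use t0 cont'[OF cy] cF in \<open>auto intro: continuous_on_subset\<close>)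
    ultimately show ?thesis by (simp add: y_def)
  qed
  then have "{a<..<b} \<subseteq> {t\<in>{a..b}. f t y0 v1 = f t y0 v2}" by auto
  moreover have "closed {t\<in>{a..b}. f t y0 v1 = f t y0 v2}"
    using continuous_closed_preimage_constant[of "{a..b}" "\<lambda>t. f t y0 v1 - f t y0 v2" 0]
    by (simp add: continuous_on_diff cont')
  ultimately have "closure {a<..<b} \<subseteq> {t\<in>{a..b}. f t y0 v1 = f t y0 v2}" by (rule closure_minimal)
  then show ?thesis using t \<open>a < b\<close> by auto
qed

section \<open>Interchanging the derivatives in the parameter and in time\<close>

lemma vector_derivative_bound:
  fixes f :: "real \<Rightarrow> 'b::real_normed_vector"
  assumes "convex I" and der: "\<And>t. t \<in> I \<Longrightarrow> (f has_vector_derivative f' t) (at t)"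
    and B: "\<And>t. t \<in> I \<Longrightarrow> norm (f' t) \<le> B" and "u \<in> I" "v \<in> I"
  shows "norm (f u - f v) \<le> B * \<bar>u - v\<bar>"
proof -
  have "B \<ge> 0" using B[OF \<open>u \<in> I\<close>] norm_ge_zero order.trans by blast
  have "norm (f u - f v) \<le> B * norm (u - v)"
  proof (rule differentiable_bound[OF \<open>convex I\<close> _ _ \<open>u \<in> I\<close> \<open>v \<in> I\<close>])
    fix t assume "t \<in> I"
    show "(f has_derivative (\<lambda>h. h *\<^sub>R f' t)) (at t within I)"
      using der[OF \<open>t \<in> I\<close>] by (auto simp: has_vector_derivative_def intro: has_derivative_at_withinI)
    show "onorm (\<lambda>h. h *\<^sub>R f' t) \<le> B"
      using B[OF \<open>t \<in> I\<close>] \<open>B \<ge> 0\<close> by (intro onorm_bound) (auto simp: mult.commute[of B] intro: mult_left_mono)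
  qed
  then show ?thesis by simp
qed

text \<open>
  With \<open>g = \<partial>f/\<partial>s\<close>, \<open>A s = D\<^sub>z f(z0,s)\<close> and \<open>D = D\<^sub>z g\<close>, this says
  \<open>\<partial>\<^sub>s D\<^sub>z f = D\<^sub>z \<partial>\<^sub>s f\<close> at \<open>(z0,0)\<close> in the direction \<open>w\<close>. The second difference
  \<open>\<Delta> h\<close> of \<open>f\<close> over the steps \<open>h w\<close> and \<open>s\<close> is compared with \<open>h s D(z0,0) w\<close>: the mean value
  inequality, first in \<open>s\<close> and then along \<open>w\<close>, reduces the error to the oscillation of \<open>D\<close> near
  \<open>(z0,0)\<close>. Dividing by \<open>h\<close> and letting \<open>h\<close> tend to \<open>0\<close> gives the difference quotient in
  \<open>s\<close>.
\<close>
lemma mixed_derivative_interchange: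
  fixes f g :: "'a::real_normed_vector \<Rightarrow> real \<Rightarrow> 'b::real_normed_vector"
    and D :: "'a \<times> real \<Rightarrow> 'a \<Rightarrow>\<^sub>L 'b"
  assumes U: "open U" "z0 \<in> U" and "0 < \<epsilon>"
    and fs: "\<And>z s. z \<in> U \<Longrightarrow> \<bar>s\<bar> < \<epsilon> \<Longrightarrow> (f z has_vector_derivative g z s) (at s)"
    and fz: "\<And>s. \<bar>s\<bar> < \<epsilon> \<Longrightarrow> ((\<lambda>z. f z s) has_derivative A s) (at z0)"
    and gz: "\<And>z s. z \<in> U \<Longrightarrow> \<bar>s\<bar> < \<epsilon> \<Longrightarrow> ((\<lambda>z. g z s) has_derivative D (z, s)) (at z)"
    and D: "isCont D (z0, 0)"
  shows "((\<lambda>s. A s w) has_vector_derivative D (z0, 0) w) (at 0)"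
  unfolding has_vector_derivative_def has_derivative_at_alt
proof (intro conjI allI impI)
  show "bounded_linear (\<lambda>h. h *\<^sub>R D (z0, 0) w)" by (rule bounded_linear_scaleR_left)
  fix e :: real assume "e > 0"
  have "isCont (\<lambda>p. D p w) (z0, 0)"
    by (intro continuous_intros D)
  then obtain d1 where d1: "d1 > 0" "\<And>p. dist p (z0, 0) < d1 \<Longrightarrow> dist (D p w) (D (z0, 0) w) < e"
    using \<open>e > 0\<close> unfolding continuous_at_eps_delta by metis
  obtain d2 where d2: "d2 > 0" "ball z0 d2 \<subseteq> U" using U open_contains_ball_eq by blast
  define d where "d = min (min (d1 / 2) d2) \<epsilon>"
  have d: "d > 0" using d1 d2 \<open>0 < \<epsilon>\<close> by (simp add: d_def)
  have near: "z \<in> U" "\<bar>s\<bar> < \<epsilon>" "norm (D (z, s) w - D (z0, 0) w) \<le> e" if "norm (z - z0) < d" "\<bar>s\<bar> < d" for z s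
  proof -
    show "z \<in> U" using d2(2) that by (auto simp: d_def dist_norm norm_minus_commute subset_iff)
    show "\<bar>s\<bar> < \<epsilon>" using that by (simp add: d_def)
    have "dist (z, s) (z0, 0) \<le> norm (z - z0) + \<bar>s\<bar>"
      using norm_Pair_le[of "z - z0" s] by (simp add: dist_norm)
    also have "\<dots> < d1" using that by (simp add: d_def)
    finally have "dist (D (z, s) w) (D (z0, 0) w) < e" by (rule d1(2))
    then show "norm (D (z, s) w - D (z0, 0) w) \<le> e" by (simp add: dist_norm)
  qed
  show "\<exists>d>0. \<forall>s. norm (s - 0) < d \<longrightarrow>
      norm (A s w - A 0 w - (s - 0) *\<^sub>R D (z0, 0) w) \<le> e * norm (s - 0)"
  proof (intro exI[of _ d] conjI allI impI)
    fix s :: real assume "norm (s - 0) < d"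
    then have s: "\<bar>s\<bar> < d" by simp
    define \<Delta> where "\<Delta> h = (f (z0 + h *\<^sub>R w) s - f z0 s) - (f (z0 + h *\<^sub>R w) 0 - f z0 0)" for h
    have line: "((\<lambda>h. f (z0 + h *\<^sub>R w) \<sigma>) has_vector_derivative A \<sigma> w) (at 0)" if "\<bar>\<sigma>\<bar> < \<epsilon>" for \<sigma>
    proof -
      have l: "((\<lambda>h::real. z0 + h *\<^sub>R w) has_derivative (\<lambda>h. h *\<^sub>R w)) (at 0)"
        by (auto intro!: derivative_eq_intros)
      have "((\<lambda>z. f z \<sigma>) has_derivative A \<sigma>) (at (z0 + 0 *\<^sub>R w))" using fz[OF that] by simp
      from has_derivative_compose[OF l this] show ?thesis
        using linear_scale[OF has_derivative_linear[OF fz[OF that]]] by (simp add: has_vector_derivative_def)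
    qed
    have \<Delta>: "(\<Delta> has_vector_derivative (A s w - A 0 w)) (at 0)"
      unfolding \<Delta>_def using s d \<open>0 < \<epsilon>\<close> near(2)[of z0 s]
      by (auto intro!: derivative_eq_intros line)
    have bound: "norm (\<Delta> h - h *\<^sub>R s *\<^sub>R D (z0, 0) w) \<le> e * \<bar>s\<bar> * h" if h: "0 < h" "h * norm w < d" for h
    proof -
      have in_U: "norm ((z0 + \<theta> *\<^sub>R w) - z0) < d" if "\<theta> \<in> {0..h}" for \<theta>
      proof -
        have "\<theta> * norm w \<le> h * norm w" using that by (intro mult_right_mono) auto
        then show ?thesis using that h by simp
      qed
      have inner: "norm (g (z0 + h *\<^sub>R w) \<sigma> - g z0 \<sigma> - h *\<^sub>R D (z0, 0) w) \<le> e * h" if \<sigma>: "\<bar>\<sigma>\<bar> < d" for \<sigma>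
      proof -
        have "norm ((g (z0 + h *\<^sub>R w) \<sigma> - h *\<^sub>R D (z0, 0) w) - (g (z0 + 0 *\<^sub>R w) \<sigma> - 0 *\<^sub>R D (z0, 0) w)) \<le> e * \<bar>h - 0\<bar>"
        proof (rule vector_derivative_bound[where I = "{0..h}"
              and f' = "\<lambda>\<theta>. D (z0 + \<theta> *\<^sub>R w, \<sigma>) w - D (z0, 0) w"])
          fix \<theta> assume \<theta>: "\<theta> \<in> {0..h}"
          have l: "((\<lambda>h::real. z0 + h *\<^sub>R w) has_derivative (\<lambda>h. h *\<^sub>R w)) (at \<theta>)"
            by (auto intro!: derivative_eq_intros)
          have "((\<lambda>\<theta>. g (z0 + \<theta> *\<^sub>R w) \<sigma>) has_vector_derivative D (z0 + \<theta> *\<^sub>R w, \<sigma>) w) (at \<theta>)"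
            using has_derivative_compose[OF l gz[OF near(1,2)[OF in_U[OF \<theta>] \<sigma>]]]
            by (simp add: has_vector_derivative_def blinfun.scaleR_right)
          then show "((\<lambda>\<theta>. g (z0 + \<theta> *\<^sub>R w) \<sigma> - \<theta> *\<^sub>R D (z0, 0) w) has_vector_derivative
              (D (z0 + \<theta> *\<^sub>R w, \<sigma>) w - D (z0, 0) w)) (at \<theta>)"
            by (auto intro!: derivative_eq_intros)
          show "norm (D (z0 + \<theta> *\<^sub>R w, \<sigma>) w - D (z0, 0) w) \<le> e"
            by (rule near(3)[OF in_U[OF \<theta>] \<sigma>])
        qed (use h in auto)
        then show ?thesis using h by (simp add: algebra_simps)
      qed
      have zh: "z0 + h *\<^sub>R w \<in> U" using near(1)[OF in_U[of h], of 0] h d by auto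
      define k where "k \<sigma> = f (z0 + h *\<^sub>R w) \<sigma> - f z0 \<sigma> - \<sigma> *\<^sub>R h *\<^sub>R D (z0, 0) w" for \<sigma>
      have "norm (k s - k 0) \<le> (e * h) * \<bar>s - 0\<bar>"
      proof (rule vector_derivative_bound[where I = "{-d<..<d}"
            and f' = "\<lambda>\<sigma>. g (z0 + h *\<^sub>R w) \<sigma> - g z0 \<sigma> - h *\<^sub>R D (z0, 0) w"])
        fix \<sigma> assume "\<sigma> \<in> {-d<..<d}"
        then have \<sigma>: "\<bar>\<sigma>\<bar> < d" by auto
        then show "norm (g (z0 + h *\<^sub>R w) \<sigma> - g z0 \<sigma> - h *\<^sub>R D (z0, 0) w) \<le> e * h" by (rule inner)
        have "\<bar>\<sigma>\<bar> < \<epsilon>" using \<sigma> by (simp add: d_def)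
        then show "(k has_vector_derivative (g (z0 + h *\<^sub>R w) \<sigma> - g z0 \<sigma> - h *\<^sub>R D (z0, 0) w)) (at \<sigma>)"
          unfolding k_def using fs[OF zh] fs[OF U(2)] by (auto intro!: derivative_eq_intros)
      qed (use s d in auto)
      then show ?thesis by (simp add: k_def \<Delta>_def algebra_simps)
    qed
    have "norm (A s w - A 0 w - s *\<^sub>R D (z0, 0) w) \<le> e * \<bar>s\<bar> + e'" if "e' > 0" for e'
    proof -
      obtain r where r: "r > 0"
        "\<And>h. norm (h - 0) < r \<Longrightarrow> norm (\<Delta> h - \<Delta> 0 - (h - 0) *\<^sub>R (A s w - A 0 w)) \<le> e' * norm (h - 0)"
        using \<Delta> \<open>e' > 0\<close> unfolding has_vector_derivative_def has_derivative_at_alt by blast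
      \<comment> \<open>Small enough for \<open>bound\<close> and for the derivative of \<open>\<Delta>\<close> at \<open>0\<close>.\<close>
      define h where "h = min (r / 2) (d / (2 * (norm w + 1)))"
      have w: "norm w + 1 > 0" by (smt (verit) norm_ge_zero)
      have "h \<le> r / 2" unfolding h_def by (rule min.cobounded1)
      with r(1) d w have h: "0 < h" "h < r" by (auto simp: h_def)
      have "h * norm w \<le> d / (2 * (norm w + 1)) * norm w"
        by (intro mult_right_mono) (auto simp: h_def)
      also have "\<dots> < d" using d w by (simp add: field_simps add_strict_increasing2)
      finally have "h * norm w < d" .
      then have "norm (\<Delta> h - h *\<^sub>R s *\<^sub>R D (z0, 0) w) \<le> e * \<bar>s\<bar> * h" using h by (intro bound)
      moreover have "norm (\<Delta> h - h *\<^sub>R (A s w - A 0 w)) \<le> e' * h"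
        using r(2)[of h] h by (simp add: \<Delta>_def)
      moreover have "h *\<^sub>R (A s w - A 0 w - s *\<^sub>R D (z0, 0) w)
          = (\<Delta> h - h *\<^sub>R s *\<^sub>R D (z0, 0) w) - (\<Delta> h - h *\<^sub>R (A s w - A 0 w))"
        by (simp add: scaleR_diff_right)
      moreover have "norm (h *\<^sub>R (A s w - A 0 w - s *\<^sub>R D (z0, 0) w))
          = h * norm (A s w - A 0 w - s *\<^sub>R D (z0, 0) w)"
        using h by (simp only: norm_scaleR abs_of_pos)
      ultimately have "h * norm (A s w - A 0 w - s *\<^sub>R D (z0, 0) w) \<le> e * \<bar>s\<bar> * h + e' * h"
        by (metis add_mono norm_triangle_le_diff)
      then have "h * norm (A s w - A 0 w - s *\<^sub>R D (z0, 0) w) \<le> h * (e * \<bar>s\<bar> + e')"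
        by (simp only: distrib_left mult.assoc mult.commute[of h])
      then show ?thesis using h(1) by (rule mult_left_le_imp_le)
    qed
    then show "norm (A s w - A 0 w - (s - 0) *\<^sub>R D (z0, 0) w) \<le> e * norm (s - 0)"
      using field_le_epsilon[of "norm (A s w - A 0 w - s *\<^sub>R D (z0, 0) w)" "e * \<bar>s\<bar>"] by simp
  qed (use d in auto)
qed

lemma Lip_imp_continuous_on: "x \<in> Lip a b \<Longrightarrow> continuous_on {a..b} x"
  by (auto simp: Lip_def intro: lipschitz_on_continuous_on)

text \<open>
  By \<open>velocity_independent\<close> the transformation depends on \<open>(t,x)\<close> only, so its values along \<open>x\<close> are
  those of a continuously differentiable function on the Lipschitz curve \<open>z t = (t, x t, 0)\<close>. Hence the
  generator \<open>\<eta>\<close> is Lipschitz along \<open>x\<close>, although \<open>x\<close> may have a merely measurable velocity.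
  Moreover the time derivative exists for every \<open>s\<close> wherever \<open>x\<close> is differentiable, so
  the exceptional set does not depend on \<open>s\<close>, and differentiation in \<open>s\<close> and in \<open>t\<close> can be
  interchanged there.
\<close>
lemma C1_family_along:
  fixes Y :: "real \<Rightarrow> real ^ 'n \<Rightarrow> real ^ 'n \<Rightarrow> real \<Rightarrow> 'b::real_normed_vector"
  assumes "a < b" and "0 < \<epsilon>" and Y: "C1_family a b \<epsilon> Y"
    and ex: "\<And>y s. y \<in> Lip a b \<Longrightarrow> s \<in> {-\<epsilon><..<\<epsilon>} \<Longrightarrow> ddt_exists a b (along a b y (\<lambda>t y v. Y t y v s))"
    and x: "x \<in> Lip a b"
  defines "\<eta> \<equiv> along a b x (\<lambda>t y v. d_s Y t y v 0)"
  shows "\<exists>C. C-lipschitz_on {a..b} \<eta>"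
    and "\<And>t. t \<in> {a..b} \<Longrightarrow> ((\<lambda>s. along a b x (\<lambda>t y v. Y t y v s) t) has_vector_derivative \<eta> t) (at 0)"
    and "\<And>t w. t \<in> {a<..<b} \<Longrightarrow> (x has_vector_derivative w) (at t) \<Longrightarrow>
      \<exists>\<eta>'. (\<eta> has_vector_derivative \<eta>') (at t) \<and>
        ((\<lambda>s. ddt a b (along a b x (\<lambda>t y v. Y t y v s)) t) has_vector_derivative \<eta>') (at 0)"
proof -
  let ?S = "{a..b} \<times> (UNIV :: (real ^ 'n) set) \<times> (UNIV :: (real ^ 'n) set)"
  let ?I = "{-\<epsilon><..<\<epsilon>}"
  define f where "f z s = (case z of (t, y, v) \<Rightarrow> Y t y v s)" for z s
  define g where "g z s = (case z of (t, y, v) \<Rightarrow> d_s Y t y v s)" for z s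
  define z where "z t = (t, x t, 0 :: real ^ 'n)" for t
  obtain Y' where Y': "\<And>t y v s. t \<in> {a..b} \<Longrightarrow> s \<in> ?I \<Longrightarrow>
      ((\<lambda>(t, x, v, s). Y t x v s) has_derivative blinfun_apply (Y' (t, y, v, s)))
        (at (t, y, v, s) within {a..b} \<times> UNIV \<times> UNIV \<times> ?I)"
    using Y unfolding C1_family_def C1_on_def by fastforce
  have g_eq: "(\<lambda>(t, x, v). d_s Y t x v s) = (\<lambda>z. g z s)" for s
    by (simp add: g_def fun_eq_iff)
  obtain D where D: "\<And>s z. s \<in> ?I \<Longrightarrow> z \<in> ?S \<Longrightarrow>
      ((\<lambda>z. g z s) has_derivative blinfun_apply (D (z, s))) (at z within ?S)"
    "continuous_on (?S \<times> ?I) D"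
    using Y unfolding C1_family_def g_eq by blast
  \<comment> \<open>The derivative of \<open>f\<close> in \<open>z = (t, x, v)\<close> for a fixed parameter.\<close>
  define A where "A p s h = Y' (fst p, fst (snd p), snd (snd p), s) (fst h, fst (snd h), snd (snd h), 0)" for p s h
  have fz: "((\<lambda>z. f z s) has_derivative A p s) (at p within ?S)" if "p \<in> ?S" "s \<in> ?I" for p s
  proof -
    obtain t y v where p: "p = (t, y, v)" "t \<in> {a..b}" using \<open>p \<in> ?S\<close> by auto
    let ?i = "\<lambda>q::real \<times> (real ^ 'n) \<times> (real ^ 'n). (fst q, fst (snd q), snd (snd q), s)"
    have i: "(?i has_derivative (\<lambda>h. (fst h, fst (snd h), snd (snd h), 0))) (at p within ?S)"
      by (auto intro!: derivative_eq_intros)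
    have sub: "?i ` ?S \<subseteq> {a..b} \<times> UNIV \<times> UNIV \<times> ?I" using \<open>s \<in> ?I\<close> by auto
    have "((\<lambda>(t, x, v, s). Y t x v s) has_derivative blinfun_apply (Y' (?i p))) (at (?i p) within ?i ` ?S)"
      using Y'[OF p(2) \<open>s \<in> ?I\<close>] sub by (auto simp: p intro: has_derivative_subset)
    from has_derivative_in_compose[OF i this] show ?thesis
      by (simp add: f_def A_def[abs_def] case_prod_unfold)
  qed
  have fs: "(f p has_vector_derivative g p s) (at s)" if "p \<in> ?S" "s \<in> ?I" for p s
  proof -
    obtain t y v where p: "p = (t, y, v)" "t \<in> {a..b}" using \<open>p \<in> ?S\<close> by auto
    have i: "((\<lambda>\<sigma>. (t, y, v, \<sigma>)) has_derivative (\<lambda>h. (0, 0, 0, h))) (at s within ?I)"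
      by (auto intro!: derivative_eq_intros)
    have sub: "(\<lambda>\<sigma>. (t, y, v, \<sigma>)) ` ?I \<subseteq> {a..b} \<times> UNIV \<times> UNIV \<times> ?I" using p by auto
    have "((\<lambda>(t, x, v, s). Y t x v s) has_derivative blinfun_apply (Y' (t, y, v, s)))
        (at (t, y, v, s) within (\<lambda>\<sigma>. (t, y, v, \<sigma>)) ` ?I)"
      by (rule has_derivative_subset[OF Y'[OF p(2) \<open>s \<in> ?I\<close>] sub])
    from has_derivative_in_compose[OF i this]
    have "(f p has_derivative (\<lambda>h. Y' (t, y, v, s) (0, 0, 0, h))) (at s within ?I)"
      by (simp add: f_def[abs_def] p)
    then have "(f p has_derivative (\<lambda>h. Y' (t, y, v, s) (0, 0, 0, h))) (at s)"
      using \<open>s \<in> ?I\<close> by (simp add: at_within_open[of s ?I])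
    then have "f p differentiable (at s)" by (auto simp: differentiable_def)
    then have "(f p has_vector_derivative vector_derivative (f p) (at s)) (at s)"
      by (simp add: vector_derivative_works)
    moreover have "vector_derivative (f p) (at s) = g p s"
      by (simp add: p g_def d_s_def f_def[abs_def])
    ultimately show ?thesis by simp
  qed
  have fcont: "continuous_on ?S (\<lambda>z. f z s)" if "s \<in> ?I" for s
    by (rule has_derivative_continuous_on[OF fz[OF _ that]])
  have indep: "Y t y v s = Y t y 0 s" if "s \<in> ?I" "t \<in> {a..b}" for s t y v
    by (rule velocity_independent[OF \<open>a < b\<close> _ ex[OF _ that(1)] that(2)])
       (use fcont[OF that(1)] in \<open>simp add: f_def case_prod_unfold\<close>)
  have zero: "0 \<in> ?I" using \<open>0 < \<epsilon>\<close> by simp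
  have z_in: "z t \<in> ?S" if "t \<in> {a..b}" for t using that by (simp add: z_def)
  have along_eq: "along a b x (\<lambda>t y v. Y t y v s) t = Y t (x t) 0 s" if "s \<in> ?I" "t \<in> {a..b}" for s t
    unfolding along_def by (rule indep[OF that])
  have along_f: "along a b x (\<lambda>t y v. Y t y v s) t = f (z t) s" if "s \<in> ?I" "t \<in> {a..b}" for s t
    using along_eq[OF that] by (simp add: f_def z_def)
  have transfer_s: "((\<lambda>s. along a b x (\<lambda>t y v. Y t y v s) t) has_vector_derivative c) (at 0)"
    if "(f (z t) has_vector_derivative c) (at 0)" "t \<in> {a..b}" for t c
    by (rule has_vector_derivative_transform_within_open[OF that(1), of ?I])
       (use along_f[OF _ that(2)] \<open>0 < \<epsilon>\<close> in auto)
  have \<eta>_eq: "\<eta> t = g (z t) 0" if "t \<in> {a..b}" for t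
  proof -
    have "(f (t, x t, velocity a b x t) has_vector_derivative \<eta> t) (at 0)"
      using fs[of "(t, x t, velocity a b x t)" 0] that zero by (simp add: \<eta>_def along_def g_def)
    then have "(f (z t) has_vector_derivative \<eta> t) (at 0)"
      by (rule has_vector_derivative_transform_within_open[of _ _ _ ?I])
         (use indep[OF _ that, where y = "x t" and v = "velocity a b x t"] \<open>0 < \<epsilon>\<close>
          in \<open>auto simp: f_def z_def\<close>)
    then show ?thesis using fs[OF z_in[OF that] zero] by (rule vector_derivative_unique_at)
  qed
  show "((\<lambda>s. along a b x (\<lambda>t y v. Y t y v s) t) has_vector_derivative \<eta> t) (at 0)"
    if "t \<in> {a..b}" for t
    using transfer_s[OF fs[OF z_in[OF that] zero] that] \<eta>_eq[OF that] by simp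
  show "\<exists>C. C-lipschitz_on {a..b} \<eta>"
  proof -
    obtain Cx where Cx: "Cx-lipschitz_on {a..b} x" using x by (auto simp: Lip_def)
    obtain B where B: "\<And>t. t \<in> {a..b} \<Longrightarrow> norm (x t) \<le> B"
      using compact_imp_bounded[OF compact_continuous_image[OF Lip_imp_continuous_on[OF x] compact_Icc]]
      unfolding bounded_iff by blast
    \<comment> \<open>The generator has a bounded derivative on a compact convex set that contains the curve.\<close>
    define K where "K = {a..b} \<times> cball (0 :: real ^ 'n) B \<times> {0 :: real ^ 'n}"
    have K: "K \<subseteq> ?S" "convex K" "compact K" "\<And>t. t \<in> {a..b} \<Longrightarrow> z t \<in> K"
      using B by (auto simp: K_def z_def intro!: convex_Times compact_Times)
    have "continuous_on K (\<lambda>p. D (p, 0))"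
      by (rule continuous_on_compose2[OF D(2)]) (use K(1) zero in \<open>auto intro!: continuous_intros\<close>)
    then have "bounded ((\<lambda>p. D (p, 0)) ` K)" using K(3) by (intro compact_imp_bounded compact_continuous_image)
    then obtain M where M: "\<And>p. p \<in> K \<Longrightarrow> norm (D (p, 0)) \<le> M" unfolding bounded_iff by blast
    have gK: "(max M 0)-lipschitz_on K (\<lambda>p. g p 0)"
    proof (rule bounded_derivative_imp_lipschitz[OF _ K(2)])
      show "((\<lambda>p. g p 0) has_derivative D (p, 0)) (at p within K)" if "p \<in> K" for p
        using D(1)[OF zero, of p] K(1) that by (blast intro: has_derivative_subset)
      show "onorm (D (p, 0)) \<le> max M 0" if "p \<in> K" for p
        using M[OF that] by (simp add: norm_blinfun.rep_eq[symmetric])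
    qed simp
    have "(1 + Cx)-lipschitz_on {a..b} z"
    proof (rule lipschitz_onI)
      fix s t assume st: "s \<in> {a..b}" "t \<in> {a..b}"
      have "dist (z s) (z t) \<le> dist s t + dist (x s) (x t)"
        using norm_Pair_le[of "s - t" "(x s - x t, 0 :: real ^ 'n)"]
        by (simp add: z_def dist_norm norm_Pair)
      also have "\<dots> \<le> dist s t + Cx * dist s t" using lipschitz_onD[OF Cx st] by simp
      finally show "dist (z s) (z t) \<le> (1 + Cx) * dist s t" by (simp add: algebra_simps)
    qed (use lipschitz_on_nonneg[OF Cx] in simp)
    then have "(max M 0 * (1 + Cx))-lipschitz_on {a..b} (\<lambda>t. g (z t) 0)"
      using lipschitz_on_compose2[of "1 + Cx" "{a..b}" z "max M 0" "\<lambda>p. g p 0"]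
        lipschitz_on_subset[OF gK, of "z ` {a..b}"] K(4) by blast
    then have "(max M 0 * (1 + Cx))-lipschitz_on {a..b} \<eta>"
      by (rule lipschitz_on_transform) (use \<eta>_eq in auto)
    then show ?thesis by blast
  qed
  fix t w assume t: "t \<in> {a<..<b}" and w: "(x has_vector_derivative w) (at t)"
  let ?U = "{a<..<b} \<times> (UNIV :: (real ^ 'n) set) \<times> (UNIV :: (real ^ 'n) set)"
  have U: "open ?U" "?U \<subseteq> ?S" "z t \<in> ?U"
    using t by (auto simp: z_def intro!: open_Times)
  have at_U: "at p within ?S = at p" if "p \<in> ?U" for p
    using U(1,2) that by (meson at_within_interior interiorI)
  have zt: "(z has_derivative (\<lambda>h. h *\<^sub>R (1, w, 0))) (at t)"
    using w unfolding z_def has_vector_derivative_def by (auto intro!: derivative_eq_intros)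
  have t': "t \<in> {a..b}" using t by simp
  have "isCont D (z t, 0)"
    using D(2) U \<open>0 < \<epsilon>\<close> by (intro continuous_on_interior[of "?S \<times> ?I"] interiorI[of "?U \<times> ?I"])
      (auto intro!: open_Times)
  note contD = this
  have gD: "((\<lambda>z. g z s) has_derivative D (p, s)) (at p)" if "p \<in> ?U" "s \<in> ?I" for p s
    using D(1)[OF that(2), of p] subsetD[OF U(2) that(1)] unfolding at_U[OF that(1)] by blast
  have fA: "((\<lambda>z. f z s) has_derivative A (z t) s) (at (z t))" if "s \<in> ?I" for s
    using fz[OF subsetD[OF U(2,3)] that] unfolding at_U[OF U(3)] .
  have main: "((\<lambda>s. A (z t) s (1, w, 0)) has_vector_derivative D (z t, 0) (1, w, 0)) (at 0)"
  proof (rule mixed_derivative_interchange[OF U(1,3) \<open>0 < \<epsilon>\<close>])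
    show "(f p has_vector_derivative g p s) (at s)" if "p \<in> ?U" "\<bar>s\<bar> < \<epsilon>" for p s
      using fs[OF subsetD[OF U(2) that(1)]] that(2) by (simp add: abs_less_iff)
    show "((\<lambda>z. f z s) has_derivative A (z t) s) (at (z t))" if "\<bar>s\<bar> < \<epsilon>" for s
      using fA that by (simp add: abs_less_iff)
    show "((\<lambda>z. g z s) has_derivative D (p, s)) (at p)" if "p \<in> ?U" "\<bar>s\<bar> < \<epsilon>" for p s
      by (rule gD[OF that(1)]) (use that(2) in auto)
  qed (rule contD)
  have ddt_eq: "ddt a b (along a b x (\<lambda>t y v. Y t y v s)) t = A (z t) s (1, w, 0)" if s: "s \<in> ?I" for s
  proof (rule ddt_of_continuous(2)[OF \<open>a < b\<close> ex[OF x s] _ t'])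
    have "continuous_on {a..b} (\<lambda>t. f (z t) s)"
      by (rule continuous_on_compose2[OF fcont[OF s]])
         (use z_in Lip_imp_continuous_on[OF x] in \<open>auto simp: z_def intro!: continuous_intros\<close>)
    then show "continuous_on {a..b} (along a b x (\<lambda>t y v. Y t y v s))"
      by (rule continuous_on_eq) (simp add: along_f[OF s])
    have "((\<lambda>t. f (z t) s) has_vector_derivative A (z t) s (1, w, 0)) (at t)"
      using has_derivative_compose[OF zt fA[OF s]]
      unfolding has_vector_derivative_def linear_scale[OF has_derivative_linear[OF fA[OF s]]] .
    then have "((\<lambda>t. f (z t) s) has_vector_derivative A (z t) s (1, w, 0)) (at t within {a..b})"
      by (rule has_vector_derivative_at_within)
    then show "(along a b x (\<lambda>t y v. Y t y v s) has_vector_derivative A (z t) s (1, w, 0)) (at t within {a..b})"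
      by (rule has_vector_derivative_transform[OF t', rotated]) (simp add: along_f[OF s])
  qed
  have "((\<lambda>s. ddt a b (along a b x (\<lambda>t y v. Y t y v s)) t) has_vector_derivative D (z t, 0) (1, w, 0)) (at 0)"
    by (rule has_vector_derivative_transform_within_open[OF main, of ?I])
       (use \<open>0 < \<epsilon>\<close> ddt_eq in auto)
  moreover have "(\<eta> has_vector_derivative D (z t, 0) (1, w, 0)) (at t)"
  proof -
    have "((\<lambda>t. g (z t) 0) has_vector_derivative D (z t, 0) (1, w, 0)) (at t)"
      using has_derivative_compose[OF zt gD[OF U(3) zero]]
      unfolding has_vector_derivative_def blinfun.scaleR_right .
    then show ?thesis
      by (rule has_vector_derivative_transform_within_open[of _ _ _ "{a<..<b}"]) (use t \<eta>_eq in auto)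
  qed
  ultimately show "\<exists>\<eta>'. (\<eta> has_vector_derivative \<eta>') (at t) \<and>
      ((\<lambda>s. ddt a b (along a b x (\<lambda>t y v. Y t y v s)) t) has_vector_derivative \<eta>') (at 0)" by blast
qed

section \<open>The infinitesimal form of quasi-invariance\<close>

lemma grad_inner:
  fixes f :: "'a::euclidean_space \<Rightarrow> real"
  assumes f: "(f has_derivative f') (at x)"
  shows "f' h = h \<bullet> grad f x"
proof -
  define G where "G = (\<Sum>b\<in>Basis. f' b *\<^sub>R b)"
  have G: "f' h = h \<bullet> G" for h
  proof -
    have "f' h = f' (\<Sum>b\<in>Basis. (h \<bullet> b) *\<^sub>R b)" by (simp add: euclidean_representation)
    also have "\<dots> = (\<Sum>b\<in>Basis. (h \<bullet> b) * f' b)"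
      using has_derivative_linear[OF f] by (simp add: linear_sum linear_scale)
    finally show ?thesis by (simp add: G_def inner_sum_right mult.commute)
  qed
  have "f' = (\<lambda>h. h \<bullet> G)" using G by auto
  then have der: "GDERIV f x :> G" using f by (simp add: gderiv_def)
  have "grad f x = G"
    unfolding grad_def
  proof (rule the_equality)
    show "GDERIV f x :> G" by (rule der)
    fix E assume "GDERIV f x :> E"
    then have "(\<lambda>h. h \<bullet> E) = (\<lambda>h. h \<bullet> G)"
      using der unfolding gderiv_def by (rule has_derivative_unique)
    then have "\<forall>h. h \<bullet> E = h \<bullet> G" by (simp add: fun_eq_iff)
    then show "E = G" by (simp add: vector_eq_ldot)
  qed
  then show ?thesis using G by simp
qed

lemma derivative_eq_partials:
  fixes L :: "real \<Rightarrow> real ^ 'n \<Rightarrow> real ^ 'n \<Rightarrow> real"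
  assumes L: "((\<lambda>(t, x, v). L t x v) has_derivative L') (at (t, y, v))" and t: "t \<in> {a<..<b}"
  shows "L' (r, p, q) = r * L_t a b L t y v + p \<bullet> L_x L t y v + q \<bullet> L_v L t y v"
proof -
  have lin: "linear L'" using L by (rule has_derivative_linear)
  have "((\<lambda>\<tau>. (\<tau>, y, v)) has_derivative (\<lambda>h. (h, 0, 0))) (at t)"
    "((\<lambda>y. (t, y, v)) has_derivative (\<lambda>h. (0, h, 0))) (at y)"
    "((\<lambda>v. (t, y, v)) has_derivative (\<lambda>h. (0, 0, h))) (at v)"
    by (auto intro!: derivative_eq_intros simp: zero_prod_def)
  note partials = this[THEN has_derivative_compose[where g = "\<lambda>(t, x, v). L t x v" and g' = L'],
      unfolded prod.case, OF L]
  have "L' (h, 0, 0) = h *\<^sub>R L' (1, 0, 0)" for h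
    using linear_scale[OF lin, of h "(1, 0, 0)"] by simp
  then have "(\<lambda>h. L' (h, 0, 0)) = (\<lambda>h. h *\<^sub>R L' (1, 0, 0))" by (rule ext)
  then have "((\<lambda>\<tau>. L \<tau> y v) has_vector_derivative L' (1, 0, 0)) (at t)"
    unfolding has_vector_derivative_def by (rule has_derivative_eq_rhs[OF partials(1)])
  then have "((\<lambda>\<tau>. L \<tau> y v) has_vector_derivative L' (1, 0, 0)) (at t within {a..b})"
    by (rule has_vector_derivative_at_within)
  then have "L_t a b L t y v = L' (1, 0, 0)"
    using vector_derivative_within_cbox[of a b t] t by (simp add: L_t_def)
  moreover have "L' (0, p, 0) = p \<bullet> L_x L t y v"
    unfolding L_x_def by (rule grad_inner[OF partials(2)])
  moreover have "L' (0, 0, q) = q \<bullet> L_v L t y v"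
    unfolding L_v_def by (rule grad_inner[OF partials(3)])
  moreover have "(r, p, q) = r *\<^sub>R (1, 0, 0) + (0, p, 0) + (0, 0, q)" by simp
  then have "L' (r, p, q) = r * L' (1, 0, 0) + L' (0, p, 0) + L' (0, 0, q)"
    using linear_add[OF lin] linear_scale[OF lin] by (metis real_scaleR_def)
  ultimately show ?thesis by simp
qed

text \<open>
  Here \<open>dT\<close> and \<open>dX\<close> stand for the time derivatives of \<open>T\<close> and \<open>X\<close> at a fixed time; the
  transformation is the identity for \<open>s = 0\<close>, so the transformed velocity \<open>dX / dT\<close> varies at the rate
  \<open>\<xi>' - \<tau>' v\<close>.
\<close>
lemma transformed_lagrangian_derivative:
  fixes L :: "real \<Rightarrow> real ^ 'n \<Rightarrow> real ^ 'n \<Rightarrow> real"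
  assumes L: "((\<lambda>(t, x, v). L t x v) has_derivative L') (at (t, y, v))"
    and T: "(T has_real_derivative \<tau>) (at 0)" "T 0 = t"
    and X: "(X has_vector_derivative \<xi>) (at 0)" "X 0 = y"
    and dT: "(dT has_real_derivative \<tau>') (at 0)" "dT 0 = 1"
    and dX: "(dX has_vector_derivative \<xi>') (at 0)" "dX 0 = v"
  shows "((\<lambda>s. L (T s) (X s) (dX s /\<^sub>R dT s) * dT s) has_real_derivative
    L' (\<tau>, \<xi>, \<xi>' - \<tau>' *\<^sub>R v) + L t y v * \<tau>') (at 0)"
proof -
  have "((\<lambda>s. inverse (dT s)) has_real_derivative - \<tau>') (at 0)"
    using dT by (auto intro!: derivative_eq_intros)
  then have "((\<lambda>s. dX s /\<^sub>R dT s) has_vector_derivative \<xi>' - \<tau>' *\<^sub>R v) (at 0)"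
    using has_vector_derivative_scaleR[OF _ dX(1)] dT(2) dX(2) by fastforce
  then have "((\<lambda>s. (T s, X s, dX s /\<^sub>R dT s)) has_vector_derivative (\<tau>, \<xi>, \<xi>' - \<tau>' *\<^sub>R v)) (at 0)"
    using T(1) X(1) by (intro has_vector_derivative_Pair) (auto simp: has_real_derivative_iff_has_vector_derivative)
  moreover have "((\<lambda>(t, x, v). L t x v) has_derivative L') (at (T 0, X 0, dX 0 /\<^sub>R dT 0))"
    using L T X dT dX by simp
  ultimately have "((\<lambda>s. L (T s) (X s) (dX s /\<^sub>R dT s)) has_derivative
      (\<lambda>h. L' (h *\<^sub>R (\<tau>, \<xi>, \<xi>' - \<tau>' *\<^sub>R v)))) (at 0)"
    unfolding has_vector_derivative_def by (auto dest: has_derivative_compose)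
  then have "((\<lambda>s. L (T s) (X s) (dX s /\<^sub>R dT s)) has_real_derivative L' (\<tau>, \<xi>, \<xi>' - \<tau>' *\<^sub>R v)) (at 0)"
    unfolding has_real_derivative_iff_has_vector_derivative has_vector_derivative_def
      linear_scale[OF has_derivative_linear[OF L]] .
  from DERIV_mult[OF this dT(1)] show ?thesis using T X dT dX by (simp add: mult.commute[of \<tau>'])
qed

section \<open>Conservation along extremals\<close>

theorem theorem3:
  fixes a b \<epsilon> :: real
    and L \<Phi> :: "real \<Rightarrow> real ^ 'n \<Rightarrow> real ^ 'n \<Rightarrow> real"
    and T :: "real \<Rightarrow> real ^ 'n \<Rightarrow> real ^ 'n \<Rightarrow> real \<Rightarrow> real"
    and X :: "real \<Rightarrow> real ^ 'n \<Rightarrow> real ^ 'n \<Rightarrow> real \<Rightarrow> real ^ 'n"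
    and x :: "real \<Rightarrow> real ^ 'n"
  assumes "a < b" and "0 < \<epsilon>"
    and "C1_on (\<lambda>(t, x, v). L t x v) ({a..b} \<times> UNIV \<times> UNIV)"
    and "C1_transformations a b \<epsilon> T X"
    and "quasi_invariant a b \<epsilon> L T X \<Phi>"
    and "x \<in> Lip a b"
    and "euler_lagrange a b L x"
    and "dubois_reymond a b L x"
  shows "\<exists>c. AE t in lebesgue_on {a..b}.
           along a b x (\<lambda>t y v. (L t y v - L_v L t y v \<bullet> v) * d_s T t y v 0
                               + L_v L t y v \<bullet> d_s X t y v 0 - \<Phi> t y v) t = c"
proof -
  define Ts where "Ts s = along a b x (\<lambda>t y v. T t y v s)" for s
  define Xs where "Xs s = along a b x (\<lambda>t y v. X t y v s)" for s
  define \<tau> where "\<tau> = along a b x (\<lambda>t y v. d_s T t y v 0)"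
  define \<xi> where "\<xi> = along a b x (\<lambda>t y v. d_s X t y v 0)"
  have inv: "ddt_exists a b (along a b y \<Phi>)"
    "\<And>s. s \<in> {-\<epsilon><..<\<epsilon>} \<Longrightarrow> ddt_exists a b (along a b y (\<lambda>t y v. T t y v s))"
    "\<And>s. s \<in> {-\<epsilon><..<\<epsilon>} \<Longrightarrow> ddt_exists a b (along a b y (\<lambda>t y v. X t y v s))"
    if "y \<in> Lip a b" for y
    using assms(5) that unfolding quasi_invariant_def Let_def by auto
  have AE_inv: "AE t in lebesgue_on {a..b}.
      ((\<lambda>s. L (Ts s t) (Xs s t) (ddt a b (Xs s) t /\<^sub>R ddt a b (Ts s) t) * ddt a b (Ts s) t)
        has_real_derivative ddt a b (along a b x \<Phi>) t) (at 0)"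
    using assms(5,6) unfolding quasi_invariant_def Let_def Ts_def Xs_def by blast
  have famT: "C1_family a b \<epsilon> T" and famX: "C1_family a b \<epsilon> X"
    and id0: "\<And>t y v. t \<in> {a..b} \<Longrightarrow> T t y v 0 = t \<and> X t y v 0 = y"
    using assms(4) by (auto simp: C1_transformations_def)
  have zero: "0 \<in> {-\<epsilon><..<\<epsilon>}" using \<open>0 < \<epsilon>\<close> by simp
  note T_along = C1_family_along[OF \<open>a < b\<close> \<open>0 < \<epsilon>\<close> famT inv(2) \<open>x \<in> Lip a b\<close>, folded Ts_def \<tau>_def]
  note X_along = C1_family_along[OF \<open>a < b\<close> \<open>0 < \<epsilon>\<close> famX inv(3) \<open>x \<in> Lip a b\<close>, folded Xs_def \<xi>_def]
  have T0: "Ts 0 t = t" and X0: "Xs 0 t = x t" if "t \<in> {a..b}" for t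
    using id0[OF that] by (auto simp: Ts_def Xs_def along_def)
  have cT0: "continuous_on {a..b} (Ts 0)" and cX0: "continuous_on {a..b} (Xs 0)"
    using T0 X0 Lip_imp_continuous_on[OF \<open>x \<in> Lip a b\<close>]
    by (auto intro: continuous_on_eq[of _ "\<lambda>t. t"] continuous_on_eq[of _ x])
  have exT0: "ddt_exists a b (Ts 0)" and exX0: "ddt_exists a b (Xs 0)"
    using inv(2,3)[OF \<open>x \<in> Lip a b\<close> zero] by (simp_all add: Ts_def Xs_def)
  obtain L' where L': "\<And>p. p \<in> {a..b} \<times> UNIV \<times> UNIV \<Longrightarrow>
      ((\<lambda>(t, x, v). L t x v) has_derivative blinfun_apply (L' p)) (at p within {a..b} \<times> UNIV \<times> UNIV)"
    using assms(3) unfolding C1_on_def by blast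
  have L'_at: "((\<lambda>(t, x, v). L t x v) has_derivative L' (t, y, v)) (at (t, y, v))"
    if "t \<in> {a<..<b}" for t y v
  proof -
    have "(t, y, v) \<in> interior ({a..b} \<times> UNIV \<times> UNIV)"
      by (rule interiorI[of "{a<..<b} \<times> UNIV \<times> UNIV"]) (use that in \<open>auto intro!: open_Times\<close>)
    then have "at (t, y, v) within {a..b} \<times> UNIV \<times> UNIV = at (t, y, v)" by (rule at_within_interior)
    then show ?thesis using L'[of "(t, y, v)"] that by simp
  qed
  obtain P where P: "abs_cont a b P" "AE t in lebesgue_on {a..b}. along a b x (L_v L) t = P t"
      "AE t in lebesgue_on {a..b}. (P has_vector_derivative ddt a b (along a b x (L_v L)) t) (at t within {a..b})"
    using ddt_exists_representative[OF \<open>a < b\<close>] assms(7) unfolding euler_lagrange_def by blast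
  have EL: "AE t in lebesgue_on {a..b}. ddt a b (along a b x (L_v L)) t = along a b x (L_x L) t"
    using assms(7) unfolding euler_lagrange_def by blast
  define h where "h = along a b x (\<lambda>t y v. L t y v - L_v L t y v \<bullet> v)"
  obtain H where H: "abs_cont a b H" "AE t in lebesgue_on {a..b}. h t = H t"
      "AE t in lebesgue_on {a..b}. (H has_vector_derivative ddt a b h t) (at t within {a..b})"
    using ddt_exists_representative[OF \<open>a < b\<close>] assms(8)
    unfolding dubois_reymond_def Let_def h_def[symmetric] by blast
  have DR: "AE t in lebesgue_on {a..b}. along a b x (L_t a b L) t = ddt a b h t"
    using assms(8) unfolding dubois_reymond_def Let_def h_def[symmetric] by blast
  obtain \<Psi> where \<Psi>: "abs_cont a b \<Psi>" "AE t in lebesgue_on {a..b}. along a b x \<Phi> t = \<Psi> t"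
      "AE t in lebesgue_on {a..b}. (\<Psi> has_vector_derivative ddt a b (along a b x \<Phi>) t) (at t within {a..b})"
    using ddt_exists_representative[OF \<open>a < b\<close> inv(1)[OF \<open>x \<in> Lip a b\<close>]] by blast
  have interior: "AE t in lebesgue_on {a..b}. t \<in> {a<..<b}"
  proof -
    have "{t\<in>{a..b}. \<not> t \<in> {a<..<b}} \<subseteq> {a, b}" by auto
    then show ?thesis
      unfolding AE_lebesgue_on_interval by (rule negligible_subset[rotated]) simp
  qed
  \<comment> \<open>The absolutely continuous representative of the conserved quantity.\<close>
  define F where "F t = H t * \<tau> t + P t \<bullet> \<xi> t - \<Psi> t" for t
  have "abs_cont a b F"
    unfolding F_def
  proof (intro abs_cont_diff abs_cont_add abs_cont_bilinear[OF bounded_bilinear_mult]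
      abs_cont_bilinear[OF bounded_bilinear_inner])
    show "abs_cont a b \<tau>" "abs_cont a b \<xi>"
      using T_along(1) X_along(1) abs_cont_lipschitz by blast+
  qed (use H P \<Psi> in auto)
  moreover have "AE t in lebesgue_on {a..b}. (F has_vector_derivative 0) (at t within {a..b})"
    using AE_inv P(2,3) EL H(2,3) DR \<Psi>(3) interior ddt_of_continuous(1)[OF \<open>a < b\<close> exX0 cX0]
  proof eventually_elim
    case (elim t)
    have t: "t \<in> {a<..<b}" "t \<in> {a..b}" using elim(9) by auto
    \<comment> \<open>\<open>x\<close> is the transformed trajectory for \<open>s = 0\<close>, so quasi-invariance makes it differentiable almost
      everywhere.\<close>
    have "x differentiable (at t within {a..b})"
      by (rule differentiable_transform_within[OF elim(10) zero_less_one t(2)]) (simp add: X0)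
    then have "x differentiable (at t)" using t(1) by (simp add: at_within_Icc_at)
    then obtain w where w: "(x has_vector_derivative w) (at t)"
      by (auto simp: vector_derivative_works)
    have v: "velocity a b x t = w"
      using vector_derivative_within_cbox[of a b t x w] has_vector_derivative_at_within[OF w] \<open>a < b\<close> t(2)
      by (simp add: velocity_def)
    obtain \<tau>' where \<tau>': "(\<tau> has_vector_derivative \<tau>') (at t)"
        "((\<lambda>s. ddt a b (Ts s) t) has_vector_derivative \<tau>') (at 0)"
      using T_along(3)[OF _ _ t(1) w] by blast
    obtain \<xi>' where \<xi>': "(\<xi> has_vector_derivative \<xi>') (at t)"
        "((\<lambda>s. ddt a b (Xs s) t) has_vector_derivative \<xi>') (at 0)"
      using X_along(3)[OF _ _ t(1) w] by blast
    have dT0: "ddt a b (Ts 0) t = 1"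
      by (rule ddt_of_continuous(2)[OF \<open>a < b\<close> exT0 cT0 t(2)],
          rule has_vector_derivative_transform[OF t(2) T0 has_vector_derivative_id])
    have dX0: "ddt a b (Xs 0) t = w"
      by (rule ddt_of_continuous(2)[OF \<open>a < b\<close> exX0 cX0 t(2)],
          rule has_vector_derivative_transform[OF t(2) X0 has_vector_derivative_at_within[OF w]])
    have "((\<lambda>s. L (Ts s t) (Xs s t) (ddt a b (Xs s) t /\<^sub>R ddt a b (Ts s) t) * ddt a b (Ts s) t)
        has_real_derivative L' (t, x t, w) (\<tau> t, \<xi> t, \<xi>' - \<tau>' *\<^sub>R w) + L t (x t) w * \<tau>') (at 0)"
      using T_along(2)[OF _ _ t(2)] X_along(2)[OF _ _ t(2)] \<tau>'(2) \<xi>'(2) T0[OF t(2)] X0[OF t(2)] dT0 dX0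
      by (intro transformed_lagrangian_derivative L'_at[OF t(1)])
         (auto simp: has_real_derivative_iff_has_vector_derivative)
    then have "ddt a b (along a b x \<Phi>) t
        = L' (t, x t, w) (\<tau> t, \<xi> t, \<xi>' - \<tau>' *\<^sub>R w) + L t (x t) w * \<tau>'"
      using elim(1) by (blast intro: DERIV_unique)
    then have \<Phi>': "ddt a b (along a b x \<Phi>) t = \<tau> t * L_t a b L t (x t) w + \<xi> t \<bullet> L_x L t (x t) w
        + (\<xi>' - \<tau>' *\<^sub>R w) \<bullet> L_v L t (x t) w + L t (x t) w * \<tau>'"
      using derivative_eq_partials[OF L'_at[OF t(1)] t(1)] by simp
    have "(F has_vector_derivative
        (H t * \<tau>' + ddt a b h t * \<tau> t) + (P t \<bullet> \<xi>' + ddt a b (along a b x (L_v L)) t \<bullet> \<xi> t)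
          - ddt a b (along a b x \<Phi>) t) (at t within {a..b})"
      unfolding F_def
      by (intro has_vector_derivative_diff has_vector_derivative_add
          bounded_bilinear.has_vector_derivative[OF bounded_bilinear_mult]
          bounded_bilinear.has_vector_derivative[OF bounded_bilinear_inner]
          has_vector_derivative_at_within[OF \<tau>'(1)] has_vector_derivative_at_within[OF \<xi>'(1)] elim)
    \<comment> \<open>The Euler-Lagrange and DuBois-Reymond equations turn the derivatives of \<open>P\<close> and \<open>H\<close> into
      partial derivatives of \<open>L\<close>, and everything cancels against the derivative of \<open>\<Phi>\<close>.\<close>
    moreover have "(H t * \<tau>' + ddt a b h t * \<tau> t) + (P t \<bullet> \<xi>' + ddt a b (along a b x (L_v L)) t \<bullet> \<xi> t)
          - ddt a b (along a b x \<Phi>) t = 0"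
    proof -
      have h': "ddt a b h t = L_t a b L t (x t) w" using elim(7) v by (simp add: along_def)
      have P': "ddt a b (along a b x (L_v L)) t = L_x L t (x t) w"
        by (subst elim(4)) (simp add: along_def v)
      have Pt: "P t = L_v L t (x t) w" using elim(2) v by (simp add: along_def)
      have Ht: "H t = L t (x t) w - L_v L t (x t) w \<bullet> w" using elim(5) v by (simp add: h_def along_def)
      show ?thesis unfolding \<Phi>' h' P' Pt Ht by (simp add: algebra_simps inner_commute)
    qed
    ultimately show ?case by simp
  qed
  ultimately have F: "F t = F a" if "t \<in> {a..b}" for t
    using that by (intro abs_cont_zero_deriv_imp_constant)
  have "AE t in lebesgue_on {a..b}. along a b x (\<lambda>t y v. (L t y v - L_v L t y v \<bullet> v) * d_s T t y v 0
                               + L_v L t y v \<bullet> d_s X t y v 0 - \<Phi> t y v) t = F a"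
    using H(2) P(2) \<Psi>(2) interior
  proof eventually_elim
    case (elim t)
    then have "F t = F a" by (intro F) auto
    then show ?case
      using elim by (simp add: F_def h_def \<tau>_def \<xi>_def along_def)
  qed
  then show ?thesis by blast
qed

end
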